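(* Let $\mathcal A$ be an additive category and let $[f]\colon A\to B$ be a morphism in $\operatorname{Adel}(\mathcal A)$, represented by $f=(f_0,f_1,f_2)$. Consider the following objects of $\operatorname{Adel}(\mathcal A)$: $$K=\Bigl(A_0\oplus B_0\xrightarrow{\left(\begin{smallmatrix}a_0&0\\ 0&1\end{smallmatrix}\right)}A_1\oplus B_0\xrightarrow{\left(\begin{smallmatrix}a_1&f_1\\ 0&-b_0\end{smallmatrix}\right)}A_2\oplus B_1\Bigr),$$ $$C=\Bigl(B_0\oplus A_1\xrightarrow{\left(\begin{smallmatrix}b_0&0\\ f_1&-a_1\end{smallmatrix}\right)}B_1\oplus A_2\xrightarrow{\left(\begin{smallmatrix}b_1&0\\ 0&1\end{smallmatrix}\right)}B_2\oplus A_2\Bigr),$$ $$J=\Bigl(A_0\oplus A_1\oplus B_0\xrightarrow{\left(\begin{smallmatrix}a_0&0&0\\ 1&-a_1&-f_1\\ 0&0&b_0\end{smallmatrix}\right)}A_1\oplus A_2\oplus B_1\xrightarrow{\left(\begin{smallmatrix}a_1&0&0\\ 0&1&0\\ 0&0&1\end{smallmatrix}\right)}A_2\oplus A_2\oplus B_1\Bigr),$$ $$I=\Bigl(B_0\oplus B_0\oplus A_1\xrightarrow{\left(\begin{smallmatrix}b_0&0&0\\ 0&1&0\\ 0&0&1\end{smallmatrix}\right)}B_1\oplus B_0\oplus A_1\xrightarrow{\left(\begin{smallmatrix}b_1&1&0\\ 0&-b_0&0\\ 0&-f_1&a_1\end{smallmatrix}\right)}B_2\oplus B_1\oplus A_2\Bigr).$$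 Then the following morphisms in $\operatorname{Adel}(\mathcal A)$ form a kernel-cokernel-factorisation of $[f]$: the kernel $\bigl[\left(\begin{smallmatrix}1\\ 0\end{smallmatrix}\right),\left(\begin{smallmatrix}1\\ 0\end{smallmatrix}\right),\left(\begin{smallmatrix}1\\ 0\end{smallmatrix}\right)\bigr]\colon K\to A$ of $[f]$; the cokernel $\bigl[(1\ 0),(1\ 0),(1\ 0)\bigr]\colon B\to C$ of $[f]$; the cokernel $\bigl[(1\ 0\ 0),(1\ 0\ 0),(1\ 0\ 0)\bigr]\colon A\to J$ of the former kernel; the kernel $\Bigl[\left(\begin{smallmatrix}1\\ 0\\ 0\end{smallmatrix}\right),\left(\begin{smallmatrix}1\\ 0\\ 0\end{smallmatrix}\right),\left(\begin{smallmatrix}1\\ 0\\ 0\end{smallmatrix}\right)\Bigr]\colon I\to B$ of the former cokernel $B\to C$; and the induced morphism $$\Bigl[\left(\begin{smallmatrix}f_0&0&a_0\\ 0&0&1\\ 1&0&0\end{smallmatrix}\right),\left(\begin{smallmatrix}f_1&0&1\\ 0&0&0\\ 1&0&0\end{smallmatrix}\right),\left(\begin{smallmatrix}f_2&0&1\\ 0&0&0\\ b_1&1&0\end{smallmatrix}\right)\Bigr]\colon J\to I,$$ which is an isomorphism with inverse $$\Bigl[\left(\begin{smallmatrix}0&0&1\\ 0&0&-1\\ 0&1&0\end{smallmatrix}\right),\left(\begin{smallmatrix}0&0&1\\ 0&0&-b_0\\ 1&-a_1&-f_1\end{smallmatrix}\right),\left(\begin{smallmatrix}0&0&0\\ 0&0&1\\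 1&-1&0\end{smallmatrix}\right)\Bigr]\colon I\to J.$$
   Context: Conventions: morphisms are composed from left to right ($fg$ means first $f$, then $g$). A morphism $\bigoplus_k A_k\to\bigoplus_\ell B_\ell$ is written as a matrix $(f_{k\ell})$ with $f_{k\ell}\colon A_k\to B_\ell$ (rows indexed by the source), so that composition $fg$ is the matrix product in the written order. Adelman category: for an additive category $\mathcal A$, let $\mathcal A^{\Delta_2}$ be the category whose objects are diagrams $A=(A_0\xrightarrow{a_0}A_1\xrightarrow{a_1}A_2)$ in $\mathcal A$ (with no condition on $a_0a_1$) and whose morphisms $f\colon A\to B$ are triples $f=(f_0,f_1,f_2)$, $f_i\colon A_i\to B_i$, with $a_0f_1=f_0b_0$ and $a_1f_2=f_1b_1$. Such an $f$ is null-homotopic if there are morphisms $s\colon A_1\to B_0$ and $t\colon A_2\to B_1$ in $\mathcal A$ with $sb_0+a_1t=f_1$. The null-homotopic morphisms form an ideal of $\mathcal A^{\Delta_2}$, and $\operatorname{Adel}(\mathcal A)$ is the quotient category (same objects; morphisms are residue classes $[f]=[f_0,f_1,f_2]$). Kernel-cokernel-factorisation: given a morphism $g\colon X\to Y$ in a preadditive category with kernel $k$, cokernel $c$, a cokernel $p\colon X\to J$ of $k$ and a kernel $i\colon I\to Y$ of $c$, there is a unique $\hat g\colon J\to I$ with $p\hat gi=g$; these data form a kernel-cokernel-factorisation of $g$, and $\hat g$ is its induced morphism. *)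

theory Defs
  imports Main
begin

section \<open>Preadditive and additive categories\<close>

text \<open>Every arrow determines its source and its target, and composition is written from left to
  right. The operations are only specified on arrows for which they make sense.\<close>

record ('o, 'm) precat =
  Obj :: "'o set"
  Arr :: "'m set"
  Dom :: "'m \<Rightarrow> 'o"
  Cod :: "'m \<Rightarrow> 'o"
  Ide :: "'o \<Rightarrow> 'm"  ("\<one>\<index>")
  Comp :: "'m \<Rightarrow> 'm \<Rightarrow> 'm"  (infixl "\<cdot>\<index>" 70)
  Zero :: "'o \<Rightarrow> 'o \<Rightarrow> 'm"  ("\<zero>\<index>")
  Add :: "'m \<Rightarrow> 'm \<Rightarrow> 'm"  (infixl "\<oplus>\<index>" 65)
  Neg :: "'m \<Rightarrow> 'm"  ("\<ominus>\<index> _" [81] 80)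

definition Hom :: "('o, 'm, 'e) precat_scheme \<Rightarrow> 'o \<Rightarrow> 'o \<Rightarrow> 'm set"
  where "Hom C A B = {f \<in> Arr C. Dom C f = A \<and> Cod C f = B}"

locale category =
  fixes C :: "('o, 'm, 'e) precat_scheme" (structure)
  assumes Dom_Obj: "f \<in> Arr C \<Longrightarrow> Dom C f \<in> Obj C"
    and Cod_Obj: "f \<in> Arr C \<Longrightarrow> Cod C f \<in> Obj C"
    and Ide_Hom: "A \<in> Obj C \<Longrightarrow> \<one> A \<in> Hom C A A"
    and Comp_Hom: "f \<in> Hom C X Y \<Longrightarrow> g \<in> Hom C Y Z \<Longrightarrow> f \<cdot> g \<in> Hom C X Z"
    and Ide_left: "f \<in> Hom C X Y \<Longrightarrow> \<one> X \<cdot> f = f"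
    and Ide_right: "f \<in> Hom C X Y \<Longrightarrow> f \<cdot> \<one> Y = f"
    and Comp_assoc: "f \<in> Hom C W X \<Longrightarrow> g \<in> Hom C X Y \<Longrightarrow> h \<in> Hom C Y Z \<Longrightarrow>
      f \<cdot> g \<cdot> h = f \<cdot> (g \<cdot> h)"

locale preadditive_category = category +
  assumes Zero_Hom: "A \<in> Obj C \<Longrightarrow> B \<in> Obj C \<Longrightarrow> \<zero> A B \<in> Hom C A B"
    and Add_Hom: "f \<in> Hom C A B \<Longrightarrow> g \<in> Hom C A B \<Longrightarrow> f \<oplus> g \<in> Hom C A B"
    and Neg_Hom: "f \<in> Hom C A B \<Longrightarrow> \<ominus> f \<in> Hom C A B"
    and Add_assoc: "f \<in> Hom C A B \<Longrightarrow> g \<in> Hom C A B \<Longrightarrow> h \<in> Hom C A B \<Longrightarrow>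
      f \<oplus> g \<oplus> h = f \<oplus> (g \<oplus> h)"
    and Add_commute: "f \<in> Hom C A B \<Longrightarrow> g \<in> Hom C A B \<Longrightarrow> f \<oplus> g = g \<oplus> f"
    and Add_Zero: "f \<in> Hom C A B \<Longrightarrow> f \<oplus> \<zero> A B = f"
    and Add_Neg: "f \<in> Hom C A B \<Longrightarrow> f \<oplus> \<ominus> f = \<zero> A B"
    and Comp_Add_left: "f \<in> Hom C X Y \<Longrightarrow> f' \<in> Hom C X Y \<Longrightarrow> g \<in> Hom C Y Z \<Longrightarrow>
      (f \<oplus> f') \<cdot> g = f \<cdot> g \<oplus> f' \<cdot> g"
    and Comp_Add_right: "f \<in> Hom C X Y \<Longrightarrow> g \<in> Hom C Y Z \<Longrightarrow> g' \<in> Hom C Y Z \<Longrightarrow>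
      f \<cdot> (g \<oplus> g') = f \<cdot> g \<oplus> f \<cdot> g'"

definition hom_sum :: "('o, 'm, 'e) precat_scheme \<Rightarrow> 'o \<Rightarrow> 'o \<Rightarrow> 'm list \<Rightarrow> 'm"
  where "hom_sum C A B fs = foldr (Add C) fs (Zero C A B)"

definition is_direct_sum ::
  "('o, 'm, 'e) precat_scheme \<Rightarrow> 'o list \<Rightarrow> 'o \<Rightarrow> (nat \<Rightarrow> 'm) \<Rightarrow> (nat \<Rightarrow> 'm) \<Rightarrow> bool"
  where "is_direct_sum C As S \<iota> \<pi> \<longleftrightarrow>
    set As \<subseteq> Obj C \<and> S \<in> Obj C \<and>
    (\<forall>k < length As. \<iota> k \<in> Hom C (As ! k) S \<and> \<pi> k \<in> Hom C S (As ! k)) \<and>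
    (\<forall>k < length As. \<forall>l < length As.
      Comp C (\<iota> k) (\<pi> l) = (if k = l then Ide C (As ! k) else Zero C (As ! k) (As ! l))) \<and>
    hom_sum C S S (map (\<lambda>k. Comp C (\<pi> k) (\<iota> k)) [0..<length As]) = Ide C S"

locale additive_category = preadditive_category +
  assumes ex_direct_sum: "set As \<subseteq> Obj C \<Longrightarrow> \<exists>S \<iota> \<pi>. is_direct_sum C As S \<iota> \<pi>"

text \<open>A choice of direct sums. A single object, as the source or target of a matrix with one row
  or one column, is its own direct sum.\<close>

record ('o, 'm) dsums =
  dsum :: "'o list \<Rightarrow> 'o"
  dinj :: "'o list \<Rightarrow> nat \<Rightarrow> 'm"
  dproj :: "'o list \<Rightarrow> nat \<Rightarrow> 'm"

definition direct_sum_choice :: "('o, 'm, 'e) precat_scheme \<Rightarrow> ('o, 'm, 'd) dsums_scheme \<Rightarrow> bool"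
  where "direct_sum_choice C D \<longleftrightarrow>
    (\<forall>As. set As \<subseteq> Obj C \<longrightarrow> is_direct_sum C As (dsum D As) (dinj D As) (dproj D As)) \<and>
    (\<forall>A \<in> Obj C. dsum D [A] = A \<and> dinj D [A] 0 = Ide C A \<and> dproj D [A] 0 = Ide C A)"

definition matrix ::
  "('o, 'm, 'e) precat_scheme \<Rightarrow> ('o, 'm, 'd) dsums_scheme \<Rightarrow> 'o list \<Rightarrow> 'o list \<Rightarrow> 'm list list \<Rightarrow> 'm"
  where "matrix C D As Bs M = hom_sum C (dsum D As) (dsum D Bs)
    [Comp C (Comp C (dproj D As k) (M ! k ! l)) (dinj D Bs l).
      k \<leftarrow> [0..<length As], l \<leftarrow> [0..<length Bs]]"


section \<open>Kernels and cokernels\<close>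

definition is_kernel :: "('o, 'm, 'e) precat_scheme \<Rightarrow> 'm \<Rightarrow> 'm \<Rightarrow> bool"
  where "is_kernel C g k \<longleftrightarrow>
    g \<in> Arr C \<and> k \<in> Arr C \<and> Cod C k = Dom C g \<and>
    Comp C k g = Zero C (Dom C k) (Cod C g) \<and>
    (\<forall>T \<in> Obj C. \<forall>t \<in> Hom C T (Dom C g). Comp C t g = Zero C T (Cod C g) \<longrightarrow>
      (\<exists>!u. u \<in> Hom C T (Dom C k) \<and> Comp C u k = t))"

definition is_cokernel :: "('o, 'm, 'e) precat_scheme \<Rightarrow> 'm \<Rightarrow> 'm \<Rightarrow> bool"
  where "is_cokernel C g c \<longleftrightarrow>
    g \<in> Arr C \<and> c \<in> Arr C \<and> Dom C c = Cod C g \<and>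
    Comp C g c = Zero C (Dom C g) (Cod C c) \<and>
    (\<forall>T \<in> Obj C. \<forall>t \<in> Hom C (Cod C g) T. Comp C g t = Zero C (Dom C g) T \<longrightarrow>
      (\<exists>!u. u \<in> Hom C (Cod C c) T \<and> Comp C c u = t))"

definition is_induced_morphism ::
  "('o, 'm, 'e) precat_scheme \<Rightarrow> 'm \<Rightarrow> 'm \<Rightarrow> 'm \<Rightarrow> 'm \<Rightarrow> bool"
  where "is_induced_morphism C g p i h \<longleftrightarrow>
    h \<in> Hom C (Cod C p) (Dom C i) \<and> Comp C (Comp C p h) i = g \<and>
    (\<forall>h' \<in> Hom C (Cod C p) (Dom C i). Comp C (Comp C p h') i = g \<longrightarrow> h' = h)"

definition kernel_cokernel_factorisation ::
  "('o, 'm, 'e) precat_scheme \<Rightarrow> 'm \<Rightarrow> 'm \<Rightarrow> 'm \<Rightarrow> 'm \<Rightarrow> 'm \<Rightarrow> 'm \<Rightarrow> bool"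
  where "kernel_cokernel_factorisation C g k c p i h \<longleftrightarrow>
    is_kernel C g k \<and> is_cokernel C g c \<and> is_cokernel C k p \<and> is_kernel C c i \<and>
    is_induced_morphism C g p i h"

definition is_inverse :: "('o, 'm, 'e) precat_scheme \<Rightarrow> 'm \<Rightarrow> 'm \<Rightarrow> bool"
  where "is_inverse C f g \<longleftrightarrow>
    f \<in> Arr C \<and> g \<in> Hom C (Cod C f) (Dom C f) \<and>
    Comp C f g = Ide C (Dom C f) \<and> Comp C g f = Ide C (Cod C f)"


section \<open>Quotient of a preadditive category by an ideal\<close>

definition is_ideal :: "('o, 'm, 'e) precat_scheme \<Rightarrow> 'm set \<Rightarrow> bool"
  where "is_ideal C N \<longleftrightarrow>
    N \<subseteq> Arr C \<and>
    (\<forall>A \<in> Obj C. \<forall>B \<in> Obj C. Zero C A B \<in> N) \<and>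
    (\<forall>A B. \<forall>f \<in> N \<inter> Hom C A B. \<forall>g \<in> N \<inter> Hom C A B. Add C f g \<in> N) \<and>
    (\<forall>f \<in> N. Neg C f \<in> N) \<and>
    (\<forall>f \<in> N. \<forall>g \<in> Arr C. Cod C f = Dom C g \<longrightarrow> Comp C f g \<in> N) \<and>
    (\<forall>f \<in> Arr C. \<forall>g \<in> N. Cod C f = Dom C g \<longrightarrow> Comp C f g \<in> N)"

definition residue_class :: "('o, 'm, 'e) precat_scheme \<Rightarrow> 'm set \<Rightarrow> 'm \<Rightarrow> 'm set"
  where "residue_class C N f = {g \<in> Hom C (Dom C f) (Cod C f). Add C g (Neg C f) \<in> N}"

text \<open>The operations on residue classes are computed on arbitrarily chosen representatives; for
  an ideal the results do not depend on this choice.\<close>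

definition quotient_category :: "('o, 'm, 'e) precat_scheme \<Rightarrow> 'm set \<Rightarrow> ('o, 'm set) precat"
  where "quotient_category C N =
    (let cl = residue_class C N; rep = (\<lambda>F. SOME f. f \<in> F) in
    \<lparr> Obj = Obj C,
      Arr = cl ` Arr C,
      Dom = (\<lambda>F. Dom C (rep F)),
      Cod = (\<lambda>F. Cod C (rep F)),
      Ide = (\<lambda>A. cl (Ide C A)),
      Comp = (\<lambda>F G. cl (Comp C (rep F) (rep G))),
      Zero = (\<lambda>A B. cl (Zero C A B)),
      Add = (\<lambda>F G. cl (Add C (rep F) (rep G))),
      Neg = (\<lambda>F. cl (Neg C (rep F))) \<rparr>)"


section \<open>The Adelman category\<close>

text \<open>A diagram is given by its two arrows; its three objects are recovered from these.\<close>

datatype 'm diag = Diag (d0: 'm) (d1: 'm)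

datatype 'm diag_mor = Mor (src: "'m diag") (trg: "'m diag") (m0: 'm) (m1: 'm) (m2: 'm)

definition diags :: "('o, 'm, 'e) precat_scheme \<Rightarrow> 'm diag set"
  where "diags C = {A. d0 A \<in> Arr C \<and> d1 A \<in> Arr C \<and> Cod C (d0 A) = Dom C (d1 A)}"

definition ob0 :: "('o, 'm, 'e) precat_scheme \<Rightarrow> 'm diag \<Rightarrow> 'o"
  where "ob0 C A = Dom C (d0 A)"

definition ob1 :: "('o, 'm, 'e) precat_scheme \<Rightarrow> 'm diag \<Rightarrow> 'o"
  where "ob1 C A = Dom C (d1 A)"

definition ob2 :: "('o, 'm, 'e) precat_scheme \<Rightarrow> 'm diag \<Rightarrow> 'o"
  where "ob2 C A = Cod C (d1 A)"

definition diag_category :: "('o, 'm, 'e) precat_scheme \<Rightarrow> ('m diag, 'm diag_mor) precat"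
  where "diag_category C =
    \<lparr> Obj = diags C,
      Arr = {f. src f \<in> diags C \<and> trg f \<in> diags C \<and>
        m0 f \<in> Hom C (ob0 C (src f)) (ob0 C (trg f)) \<and>
        m1 f \<in> Hom C (ob1 C (src f)) (ob1 C (trg f)) \<and>
        m2 f \<in> Hom C (ob2 C (src f)) (ob2 C (trg f)) \<and>
        Comp C (d0 (src f)) (m1 f) = Comp C (m0 f) (d0 (trg f)) \<and>
        Comp C (d1 (src f)) (m2 f) = Comp C (m1 f) (d1 (trg f))},
      Dom = src,
      Cod = trg,
      Ide = (\<lambda>A. Mor A A (Ide C (ob0 C A)) (Ide C (ob1 C A)) (Ide C (ob2 C A))),
      Comp = (\<lambda>f g. Mor (src f) (trg g)
        (Comp C (m0 f) (m0 g)) (Comp C (m1 f) (m1 g)) (Comp C (m2 f) (m2 g))),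
      Zero = (\<lambda>A B. Mor A B
        (Zero C (ob0 C A) (ob0 C B)) (Zero C (ob1 C A) (ob1 C B)) (Zero C (ob2 C A) (ob2 C B))),
      Add = (\<lambda>f g. Mor (src f) (trg f)
        (Add C (m0 f) (m0 g)) (Add C (m1 f) (m1 g)) (Add C (m2 f) (m2 g))),
      Neg = (\<lambda>f. Mor (src f) (trg f) (Neg C (m0 f)) (Neg C (m1 f)) (Neg C (m2 f))) \<rparr>"

definition null_homotopic :: "('o, 'm, 'e) precat_scheme \<Rightarrow> 'm diag_mor set"
  where "null_homotopic C = {f \<in> Arr (diag_category C).
    \<exists>s \<in> Hom C (ob1 C (src f)) (ob0 C (trg f)). \<exists>t \<in> Hom C (ob2 C (src f)) (ob1 C (trg f)).
      Add C (Comp C s (d0 (trg f))) (Comp C (d1 (src f)) t) = m1 f}"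

definition Adel :: "('o, 'm, 'e) precat_scheme \<Rightarrow> ('m diag, 'm diag_mor set) precat"
  where "Adel C = quotient_category (diag_category C) (null_homotopic C)"

definition adel_class :: "('o, 'm, 'e) precat_scheme \<Rightarrow> 'm diag_mor \<Rightarrow> 'm diag_mor set"
  where "adel_class C = residue_class (diag_category C) (null_homotopic C)"

section \<open>Well-definedness\<close>

context preadditive_category
begin

lemma Hom_Obj: "f \<in> Hom C A B \<Longrightarrow> A \<in> Obj C" "f \<in> Hom C A B \<Longrightarrow> B \<in> Obj C"
  using Dom_Obj Cod_Obj by (auto simp: Hom_def)

lemma Zero_Add: "f \<in> Hom C A B \<Longrightarrow> \<zero> A B \<oplus> f = f"
  using Add_commute[of "\<zero> A B" A B f] Add_Zero[of f A B] Zero_Hom Hom_Obj by simp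

lemma Add_left_commute:
  assumes "f \<in> Hom C A B" "g \<in> Hom C A B" "h \<in> Hom C A B"
  shows "f \<oplus> (g \<oplus> h) = g \<oplus> (f \<oplus> h)"
  using Add_assoc[OF assms] Add_assoc[OF assms(2,1,3)] Add_commute[OF assms(1,2)] by simp

lemma Neg_Add: "f \<in> Hom C A B \<Longrightarrow> \<ominus> f \<oplus> f = \<zero> A B"
  using Add_commute[of "\<ominus> f" A B f] Add_Neg Neg_Hom by simp

lemma Neg_Add_cancel: "f \<in> Hom C A B \<Longrightarrow> g \<in> Hom C A B \<Longrightarrow> \<ominus> f \<oplus> (f \<oplus> g) = g"
  using Add_assoc[of "\<ominus> f" A B f g] Neg_Add Neg_Hom Zero_Add by simp

lemma Neg_unique:
  assumes "f \<in> Hom C A B" "g \<in> Hom C A B" "f \<oplus> g = \<zero> A B"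
  shows "\<ominus> f = g"
  using Neg_Add_cancel[OF assms(1,2)] assms(3) Add_Zero[OF Neg_Hom[OF assms(1)]] by simp

lemma Neg_Neg: "f \<in> Hom C A B \<Longrightarrow> \<ominus> (\<ominus> f) = f"
  using Neg_unique[OF Neg_Hom _ Neg_Add] by blast

lemma Neg_Zero: "A \<in> Obj C \<Longrightarrow> B \<in> Obj C \<Longrightarrow> \<ominus> \<zero> A B = \<zero> A B"
  using Neg_unique[OF Zero_Hom Zero_Hom] Add_Zero Zero_Hom by blast

lemma Neg_distrib:
  assumes f: "f \<in> Hom C A B" and g: "g \<in> Hom C A B"
  shows "\<ominus> (f \<oplus> g) = \<ominus> f \<oplus> \<ominus> g"
proof (rule Neg_unique[OF Add_Hom[OF f g] Add_Hom[OF Neg_Hom[OF f] Neg_Hom[OF g]]])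
  have "f \<oplus> g \<oplus> (\<ominus> f \<oplus> \<ominus> g) = f \<oplus> (\<ominus> f \<oplus> (g \<oplus> \<ominus> g))"
    using Add_assoc[OF f g Add_Hom[OF Neg_Hom[OF f] Neg_Hom[OF g]]]
      Add_left_commute[OF g Neg_Hom[OF f] Neg_Hom[OF g]] by simp
  also have "\<dots> = \<zero> A B"
    using Add_Neg[OF f] Add_Neg[OF g] Add_Zero[OF Neg_Hom[OF f]] by simp
  finally show "f \<oplus> g \<oplus> (\<ominus> f \<oplus> \<ominus> g) = \<zero> A B" .
qed

lemma Comp_Zero_right:
  assumes f: "f \<in> Hom C X Y" and Z: "Z \<in> Obj C"
  shows "f \<cdot> \<zero> Y Z = \<zero> X Z"
proof -
  have z: "\<zero> Y Z \<in> Hom C Y Z" using Zero_Hom Hom_Obj f Z by blast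
  have fz: "f \<cdot> \<zero> Y Z \<in> Hom C X Z" using Comp_Hom f z by blast
  have "f \<cdot> \<zero> Y Z \<oplus> f \<cdot> \<zero> Y Z = f \<cdot> \<zero> Y Z"
    using Comp_Add_right[OF f z z] Add_Zero[OF z] by simp
  then show ?thesis using Neg_Add_cancel[OF fz fz] Neg_Add[OF fz] by simp
qed

lemma Comp_Zero_left:
  assumes f: "f \<in> Hom C Y Z" and X: "X \<in> Obj C"
  shows "\<zero> X Y \<cdot> f = \<zero> X Z"
proof -
  have z: "\<zero> X Y \<in> Hom C X Y" using Zero_Hom Hom_Obj f X by blast
  have fz: "\<zero> X Y \<cdot> f \<in> Hom C X Z" using Comp_Hom f z by blast
  have "\<zero> X Y \<cdot> f \<oplus> \<zero> X Y \<cdot> f = \<zero> X Y \<cdot> f"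
    using Comp_Add_left[OF z z f] Add_Zero[OF z] by simp
  then show ?thesis using Neg_Add_cancel[OF fz fz] Neg_Add[OF fz] by simp
qed

lemma Comp_Neg_right:
  assumes f: "f \<in> Hom C X Y" and g: "g \<in> Hom C Y Z"
  shows "f \<cdot> \<ominus> g = \<ominus> (f \<cdot> g)"
proof (rule sym, rule Neg_unique[OF Comp_Hom[OF f g] Comp_Hom[OF f Neg_Hom[OF g]]])
  show "f \<cdot> g \<oplus> f \<cdot> \<ominus> g = \<zero> X Z"
    using Comp_Add_right[OF f g Neg_Hom[OF g]] Add_Neg[OF g] Comp_Zero_right[OF f Hom_Obj(2)[OF g]]
    by simp
qed

lemma Comp_Neg_left:
  assumes f: "f \<in> Hom C X Y" and g: "g \<in> Hom C Y Z"
  shows "\<ominus> f \<cdot> g = \<ominus> (f \<cdot> g)"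
proof (rule sym, rule Neg_unique[OF Comp_Hom[OF f g] Comp_Hom[OF Neg_Hom[OF f] g]])
  show "f \<cdot> g \<oplus> \<ominus> f \<cdot> g = \<zero> X Z"
    using Comp_Add_left[OF f Neg_Hom[OF f] g] Add_Neg[OF f] Comp_Zero_left[OF g Hom_Obj(1)[OF f]]
    by simp
qed

end

locale preadditive_quotient = preadditive_category +
  fixes N :: "'b set"
  assumes ideal: "is_ideal C N"
begin

abbreviation "cl \<equiv> residue_class C N"
abbreviation "Q \<equiv> quotient_category C N"

lemma N_Zero: "A \<in> Obj C \<Longrightarrow> B \<in> Obj C \<Longrightarrow> \<zero> A B \<in> N"
  and N_Add: "f \<in> N \<Longrightarrow> g \<in> N \<Longrightarrow> f \<in> Hom C A B \<Longrightarrow> g \<in> Hom C A B \<Longrightarrow> f \<oplus> g \<in> N"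
  and N_Neg: "f \<in> N \<Longrightarrow> \<ominus> f \<in> N"
  using ideal unfolding is_ideal_def by blast+

lemma N_Comp_left: "f \<in> N \<Longrightarrow> f \<in> Hom C X Y \<Longrightarrow> g \<in> Hom C Y Z \<Longrightarrow> f \<cdot> g \<in> N"
  using ideal unfolding is_ideal_def Hom_def by auto

lemma N_Comp_right: "g \<in> N \<Longrightarrow> f \<in> Hom C X Y \<Longrightarrow> g \<in> Hom C Y Z \<Longrightarrow> f \<cdot> g \<in> N"
  using ideal unfolding is_ideal_def Hom_def by auto

lemma cl_Hom: "f \<in> Hom C A B \<Longrightarrow> cl f = {g \<in> Hom C A B. g \<oplus> \<ominus> f \<in> N}"
  by (auto simp: residue_class_def Hom_def)

lemma cl_self: "f \<in> Hom C A B \<Longrightarrow> f \<in> cl f"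
  by (simp add: cl_Hom Add_Neg N_Zero Hom_Obj)

lemma Add_sub_sub:
  assumes "f \<in> Hom C A B" "g \<in> Hom C A B" "h \<in> Hom C A B"
  shows "f \<oplus> \<ominus> g \<oplus> (g \<oplus> h) = f \<oplus> h"
  using Add_assoc[OF assms(1) Neg_Hom[OF assms(2)] Add_Hom[OF assms(2,3)]]
    Neg_Add_cancel[OF assms(2,3)] by simp

lemma cl_eq_iff:
  assumes f: "f \<in> Hom C A B" and g: "g \<in> Hom C A B"
  shows "cl f = cl g \<longleftrightarrow> f \<oplus> \<ominus> g \<in> N"
proof
  assume "cl f = cl g"
  then show "f \<oplus> \<ominus> g \<in> N" using cl_self[OF f] cl_Hom[OF g] by auto
next
  have *: "cl f \<subseteq> cl g" if f: "f \<in> Hom C A B" and g: "g \<in> Hom C A B" and n: "f \<oplus> \<ominus> g \<in> N" for f g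
  proof
    fix x assume "x \<in> cl f"
    then have x: "x \<in> Hom C A B" "x \<oplus> \<ominus> f \<in> N" using cl_Hom[OF f] by auto
    have "x \<oplus> \<ominus> f \<oplus> (f \<oplus> \<ominus> g) \<in> N"
      by (rule N_Add[OF x(2) n Add_Hom[OF x(1) Neg_Hom[OF f]] Add_Hom[OF f Neg_Hom[OF g]]])
    then show "x \<in> cl g" using x cl_Hom[OF g] Add_sub_sub[OF x(1) f Neg_Hom[OF g]] by auto
  qed
  assume n: "f \<oplus> \<ominus> g \<in> N"
  have "\<ominus> (f \<oplus> \<ominus> g) = g \<oplus> \<ominus> f"
    using Neg_distrib[OF f Neg_Hom[OF g]] Neg_Neg[OF g] Add_commute[OF Neg_Hom[OF f] g] by simp
  then have "g \<oplus> \<ominus> f \<in> N" using N_Neg[OF n] by simp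
  then show "cl f = cl g" using *[OF f g n] *[OF g f] by blast
qed

lemma rep_cl:
  assumes f: "f \<in> Hom C A B"
  shows "(SOME x. x \<in> cl f) \<in> Hom C A B" "cl (SOME x. x \<in> cl f) = cl f"
proof -
  have "(SOME x. x \<in> cl f) \<in> cl f" by (rule someI, rule cl_self[OF f])
  then have *: "(SOME x. x \<in> cl f) \<in> Hom C A B" "(SOME x. x \<in> cl f) \<oplus> \<ominus> f \<in> N"
    using cl_Hom[OF f] by auto
  then show "(SOME x. x \<in> cl f) \<in> Hom C A B" "cl (SOME x. x \<in> cl f) = cl f"
    using cl_eq_iff[OF *(1) f] by auto
qed

lemma cl_Comp_cong:
  assumes f: "f \<in> Hom C X Y" "f' \<in> Hom C X Y" "cl f = cl f'"
    and g: "g \<in> Hom C Y Z" "g' \<in> Hom C Y Z" "cl g = cl g'"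
  shows "cl (f \<cdot> g) = cl (f' \<cdot> g')"
proof -
  have 1: "(f \<oplus> \<ominus> f') \<cdot> g \<in> N"
    using N_Comp_left[OF _ Add_Hom[OF f(1) Neg_Hom[OF f(2)]] g(1)] cl_eq_iff[OF f(1,2)] f(3) by simp
  have 2: "f' \<cdot> (g \<oplus> \<ominus> g') \<in> N"
    using N_Comp_right[OF _ f(2) Add_Hom[OF g(1) Neg_Hom[OF g(2)]]] cl_eq_iff[OF g(1,2)] g(3) by simp
  have e1: "(f \<oplus> \<ominus> f') \<cdot> g = f \<cdot> g \<oplus> \<ominus> (f' \<cdot> g)"
    using Comp_Add_left[OF f(1) Neg_Hom[OF f(2)] g(1)] Comp_Neg_left[OF f(2) g(1)] by simp
  have e2: "f' \<cdot> (g \<oplus> \<ominus> g') = f' \<cdot> g \<oplus> \<ominus> (f' \<cdot> g')"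
    using Comp_Add_right[OF f(2) g(1) Neg_Hom[OF g(2)]] Comp_Neg_right[OF f(2) g(2)] by simp
  have h: "f \<cdot> g \<in> Hom C X Z" "f' \<cdot> g \<in> Hom C X Z" "f' \<cdot> g' \<in> Hom C X Z"
    using Comp_Hom[OF f(1) g(1)] Comp_Hom[OF f(2) g(1)] Comp_Hom[OF f(2) g(2)] by simp_all
  have "cl (f \<cdot> g) = cl (f' \<cdot> g)" using cl_eq_iff[OF h(1,2)] 1 e1 by simp
  also have "\<dots> = cl (f' \<cdot> g')" using cl_eq_iff[OF h(2,3)] 2 e2 by simp
  finally show ?thesis .
qed

lemma cl_Add_cong:
  assumes f: "f \<in> Hom C A B" "f' \<in> Hom C A B" "cl f = cl f'"
    and g: "g \<in> Hom C A B" "g' \<in> Hom C A B" "cl g = cl g'"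
  shows "cl (f \<oplus> g) = cl (f' \<oplus> g')"
proof -
  have n: "f \<oplus> \<ominus> f' \<in> Hom C A B" "g \<oplus> \<ominus> g' \<in> Hom C A B"
    using Add_Hom[OF f(1) Neg_Hom[OF f(2)]] Add_Hom[OF g(1) Neg_Hom[OF g(2)]] by simp_all
  have "f \<oplus> \<ominus> f' \<oplus> (g \<oplus> \<ominus> g') \<in> N"
    using N_Add[OF _ _ n] cl_eq_iff[OF f(1,2)] cl_eq_iff[OF g(1,2)] f(3) g(3) by simp
  also have "f \<oplus> \<ominus> f' \<oplus> (g \<oplus> \<ominus> g') = f \<oplus> (g \<oplus> (\<ominus> f' \<oplus> \<ominus> g'))"
    using Add_assoc[OF f(1) Neg_Hom[OF f(2)] n(2)]
      Add_left_commute[OF Neg_Hom[OF f(2)] g(1) Neg_Hom[OF g(2)]] by simp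
  also have "\<dots> = f \<oplus> g \<oplus> \<ominus> (f' \<oplus> g')"
    using Add_assoc[OF f(1) g(1) Add_Hom[OF Neg_Hom[OF f(2)] Neg_Hom[OF g(2)]]]
      Neg_distrib[OF f(2) g(2)] by simp
  finally show ?thesis using cl_eq_iff[OF Add_Hom[OF f(1) g(1)] Add_Hom[OF f(2) g(2)]] by simp
qed

lemma cl_Neg_cong:
  assumes f: "f \<in> Hom C A B" "f' \<in> Hom C A B" "cl f = cl f'"
  shows "cl (\<ominus> f) = cl (\<ominus> f')"
proof -
  have "\<ominus> (f \<oplus> \<ominus> f') \<in> N" using N_Neg cl_eq_iff[OF f(1,2)] f(3) by simp
  also have "\<ominus> (f \<oplus> \<ominus> f') = \<ominus> f \<oplus> \<ominus> (\<ominus> f')"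
    by (rule Neg_distrib[OF f(1) Neg_Hom[OF f(2)]])
  finally show ?thesis using cl_eq_iff[OF Neg_Hom[OF f(1)] Neg_Hom[OF f(2)]] by simp
qed

lemma Hom_Q: "Hom Q A B = cl ` Hom C A B"
proof -
  have *: "Dom C (SOME x. x \<in> cl f) = Dom C f" "Cod C (SOME x. x \<in> cl f) = Cod C f"
    if "f \<in> Arr C" for f
    using rep_cl(1)[of f "Dom C f" "Cod C f"] that by (auto simp: Hom_def)
  show ?thesis
    by (auto simp: Hom_def[of Q] quotient_category_def Let_def *) (auto simp: Hom_def *)
qed

lemma Obj_Q: "Obj Q = Obj C" by (simp add: quotient_category_def Let_def)
lemma Ide_Q: "Ide Q A = cl (\<one> A)" by (simp add: quotient_category_def Let_def)
lemma Zero_Q: "Zero Q A B = cl (\<zero> A B)" by (simp add: quotient_category_def Let_def)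

lemma Comp_Q:
  assumes f: "f \<in> Hom C X Y" and g: "g \<in> Hom C Y Z"
  shows "Comp Q (cl f) (cl g) = cl (f \<cdot> g)"
  unfolding quotient_category_def Let_def precat.simps
  by (rule cl_Comp_cong[OF rep_cl(1)[OF f] f rep_cl(2)[OF f] rep_cl(1)[OF g] g rep_cl(2)[OF g]])

lemma Add_Q:
  assumes f: "f \<in> Hom C A B" and g: "g \<in> Hom C A B"
  shows "Add Q (cl f) (cl g) = cl (f \<oplus> g)"
  unfolding quotient_category_def Let_def precat.simps
  by (rule cl_Add_cong[OF rep_cl(1)[OF f] f rep_cl(2)[OF f] rep_cl(1)[OF g] g rep_cl(2)[OF g]])

lemma Neg_Q:
  assumes f: "f \<in> Hom C A B"
  shows "Neg Q (cl f) = cl (\<ominus> f)"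
  unfolding quotient_category_def Let_def precat.simps
  by (rule cl_Neg_cong[OF rep_cl(1)[OF f] f rep_cl(2)[OF f]])

lemma preadditive_Q: "preadditive_category Q"
proof (unfold_locales, goal_cases)
  case (1 F)
  then have "F \<in> Hom Q (Dom Q F) (Cod Q F)" by (simp add: Hom_def)
  then show ?case unfolding Hom_Q Obj_Q using Hom_Obj(1) by fast
next
  case (2 F)
  then have "F \<in> Hom Q (Dom Q F) (Cod Q F)" by (simp add: Hom_def)
  then show ?case unfolding Hom_Q Obj_Q using Hom_Obj(2) by fast
next
  case (3 A)
  then show ?case by (simp add: Hom_Q Obj_Q Ide_Q Ide_Hom)
next
  case (4 F X Y G Z)
  then obtain f g where r: "F = cl f" "G = cl g" and h: "f \<in> Hom C X Y" "g \<in> Hom C Y Z"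
    by (auto simp: Hom_Q)
  show ?case unfolding r Comp_Q[OF h] Hom_Q by (rule imageI[OF Comp_Hom[OF h]])
next
  case (5 F X Y)
  then obtain f where r: "F = cl f" and f: "f \<in> Hom C X Y"
    by (auto simp: Hom_Q)
  show ?case unfolding r Ide_Q Comp_Q[OF Ide_Hom[OF Hom_Obj(1)[OF f]] f] Ide_left[OF f] ..
next
  case (6 F X Y)
  then obtain f where r: "F = cl f" and f: "f \<in> Hom C X Y"
    by (auto simp: Hom_Q)
  show ?case unfolding r Ide_Q Comp_Q[OF f Ide_Hom[OF Hom_Obj(2)[OF f]]] Ide_right[OF f] ..
next
  case (7 F W X G Y H Z)
  then obtain f g h where r: "F = cl f" "G = cl g" "H = cl h"
    and f: "f \<in> Hom C W X" and g: "g \<in> Hom C X Y" and h: "h \<in> Hom C Y Z"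
    by (auto simp: Hom_Q)
  show ?case unfolding r Comp_Q[OF f g] Comp_Q[OF g h] Comp_Q[OF Comp_Hom[OF f g] h]
      Comp_Q[OF f Comp_Hom[OF g h]] Comp_assoc[OF f g h] ..
next
  case (8 A B)
  then show ?case by (simp add: Hom_Q Obj_Q Zero_Q Zero_Hom)
next
  case (9 F A B G)
  then obtain f g where r: "F = cl f" "G = cl g" and h: "f \<in> Hom C A B" "g \<in> Hom C A B"
    by (auto simp: Hom_Q)
  show ?case unfolding r Add_Q[OF h] Hom_Q by (rule imageI[OF Add_Hom[OF h]])
next
  case (10 F A B)
  then obtain f where r: "F = cl f" and f: "f \<in> Hom C A B"
    by (auto simp: Hom_Q)
  show ?case unfolding r Neg_Q[OF f] Hom_Q by (rule imageI[OF Neg_Hom[OF f]])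
next
  case (11 F A B G H)
  then obtain f g h where r: "F = cl f" "G = cl g" "H = cl h"
    and f: "f \<in> Hom C A B" and g: "g \<in> Hom C A B" and h: "h \<in> Hom C A B"
    by (auto simp: Hom_Q)
  show ?case unfolding r Add_Q[OF f g] Add_Q[OF g h] Add_Q[OF Add_Hom[OF f g] h]
      Add_Q[OF f Add_Hom[OF g h]] Add_assoc[OF f g h] ..
next
  case (12 F A B G)
  then obtain f g where r: "F = cl f" "G = cl g" and f: "f \<in> Hom C A B" and g: "g \<in> Hom C A B"
    by (auto simp: Hom_Q)
  show ?case unfolding r Add_Q[OF f g] Add_Q[OF g f] by (rule arg_cong[OF Add_commute[OF f g]])
next
  case (13 F A B)
  then obtain f where r: "F = cl f" and f: "f \<in> Hom C A B"
    by (auto simp: Hom_Q)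
  show ?case unfolding r Zero_Q Add_Q[OF f Zero_Hom[OF Hom_Obj[OF f]]] Add_Zero[OF f] ..
next
  case (14 F A B)
  then obtain f where r: "F = cl f" and f: "f \<in> Hom C A B"
    by (auto simp: Hom_Q)
  show ?case unfolding r Zero_Q Neg_Q[OF f] Add_Q[OF f Neg_Hom[OF f]] Add_Neg[OF f] ..
next
  case (15 F X Y F' G Z)
  then obtain f f' g where r: "F = cl f" "F' = cl f'" "G = cl g"
    and f: "f \<in> Hom C X Y" and f': "f' \<in> Hom C X Y" and g: "g \<in> Hom C Y Z"
    by (auto simp: Hom_Q)
  show ?case unfolding r Add_Q[OF f f'] Comp_Q[OF Add_Hom[OF f f'] g] Comp_Q[OF f g]
      Comp_Q[OF f' g] Add_Q[OF Comp_Hom[OF f g] Comp_Hom[OF f' g]] Comp_Add_left[OF f f' g] ..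
next
  case (16 F X Y G Z G')
  then obtain f g g' where r: "F = cl f" "G = cl g" "G' = cl g'"
    and f: "f \<in> Hom C X Y" and g: "g \<in> Hom C Y Z" and g': "g' \<in> Hom C Y Z"
    by (auto simp: Hom_Q)
  show ?case unfolding r Add_Q[OF g g'] Comp_Q[OF f Add_Hom[OF g g']] Comp_Q[OF f g]
      Comp_Q[OF f g'] Add_Q[OF Comp_Hom[OF f g] Comp_Hom[OF f g']] Comp_Add_right[OF f g g'] ..
qed

end

context preadditive_category
begin

lemma Hom_D: "f \<in> Hom (diag_category C) A B \<longleftrightarrow>
    A \<in> diags C \<and> B \<in> diags C \<and> src f = A \<and> trg f = B \<and>
    m0 f \<in> Hom C (ob0 C A) (ob0 C B) \<and>
    m1 f \<in> Hom C (ob1 C A) (ob1 C B) \<and>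
    m2 f \<in> Hom C (ob2 C A) (ob2 C B) \<and>
    d0 A \<cdot> m1 f = m0 f \<cdot> d0 B \<and> d1 A \<cdot> m2 f = m1 f \<cdot> d1 B"
  unfolding Hom_def[of "diag_category C"] unfolding diag_category_def by auto

lemma diags_Hom:
  assumes "A \<in> diags C"
  shows "d0 A \<in> Hom C (ob0 C A) (ob1 C A)" "d1 A \<in> Hom C (ob1 C A) (ob2 C A)"
  using assms by (auto simp: diags_def Hom_def ob0_def ob1_def ob2_def)

lemma diags_Obj:
  assumes "A \<in> diags C"
  shows "ob0 C A \<in> Obj C" "ob1 C A \<in> Obj C" "ob2 C A \<in> Obj C"
  using diags_Hom[OF assms] Hom_Obj by blast+

lemma D_simps:
  "Obj (diag_category C) = diags C" "Dom (diag_category C) = src" "Cod (diag_category C) = trg"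
  "Ide (diag_category C) A = Mor A A (\<one> (ob0 C A)) (\<one> (ob1 C A)) (\<one> (ob2 C A))"
  "Comp (diag_category C) f g = Mor (src f) (trg g) (m0 f \<cdot> m0 g) (m1 f \<cdot> m1 g) (m2 f \<cdot> m2 g)"
  "Zero (diag_category C) A B = Mor A B (\<zero> (ob0 C A) (ob0 C B)) (\<zero> (ob1 C A) (ob1 C B)) (\<zero> (ob2 C A) (ob2 C B))"
  "Add (diag_category C) f g = Mor (src f) (trg f) (m0 f \<oplus> m0 g) (m1 f \<oplus> m1 g) (m2 f \<oplus> m2 g)"
  "Neg (diag_category C) f = Mor (src f) (trg f) (\<ominus> m0 f) (\<ominus> m1 f) (\<ominus> m2 f)"
  by (simp_all add: diag_category_def)

lemma square_Comp:
  assumes "a \<in> Hom C A A'" "b \<in> Hom C B B'" "c \<in> Hom C X X'"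
    and f: "f \<in> Hom C A B" "f' \<in> Hom C A' B'" "a \<cdot> f' = f \<cdot> b"
    and g: "g \<in> Hom C B X" "g' \<in> Hom C B' X'" "b \<cdot> g' = g \<cdot> c"
  shows "a \<cdot> (f' \<cdot> g') = f \<cdot> g \<cdot> c"
proof -
  have "a \<cdot> (f' \<cdot> g') = f \<cdot> b \<cdot> g'" using Comp_assoc[OF assms(1) f(2) g(2)] f(3) by simp
  also have "\<dots> = f \<cdot> (g \<cdot> c)" using Comp_assoc[OF f(1) assms(2) g(2)] g(3) by simp
  also have "\<dots> = f \<cdot> g \<cdot> c" using Comp_assoc[OF f(1) g(1) assms(3)] by simp
  finally show ?thesis .
qed

lemma Hom_D_dest:
  assumes "f \<in> Hom (diag_category C) A B"
  shows Hom_D_diags: "A \<in> diags C" "B \<in> diags C"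
    and Hom_D_src: "src f = A" and Hom_D_trg: "trg f = B"
    and Hom_D_m0: "m0 f \<in> Hom C (ob0 C A) (ob0 C B)"
    and Hom_D_m1: "m1 f \<in> Hom C (ob1 C A) (ob1 C B)"
    and Hom_D_m2: "m2 f \<in> Hom C (ob2 C A) (ob2 C B)"
    and Hom_D_sq0: "d0 A \<cdot> m1 f = m0 f \<cdot> d0 B"
    and Hom_D_sq1: "d1 A \<cdot> m2 f = m1 f \<cdot> d1 B"
  using assms by (simp_all add: Hom_D)

lemmas Hom_D_m = Hom_D_m0 Hom_D_m1 Hom_D_m2

lemma Hom_DI:
  assumes "A \<in> diags C" "B \<in> diags C"
    and "f0 \<in> Hom C (ob0 C A) (ob0 C B)" "f1 \<in> Hom C (ob1 C A) (ob1 C B)"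
    and "f2 \<in> Hom C (ob2 C A) (ob2 C B)" "d0 A \<cdot> f1 = f0 \<cdot> d0 B" "d1 A \<cdot> f2 = f1 \<cdot> d1 B"
  shows "Mor A B f0 f1 f2 \<in> Hom (diag_category C) A B"
  using assms by (simp add: Hom_D)

lemma preadditive_D: "preadditive_category (diag_category C)"
proof (unfold_locales, goal_cases)
  case (1 f) then show ?case by (simp add: diag_category_def)
next
  case (2 f) then show ?case by (simp add: diag_category_def)
next
  case (3 A)
  then have A: "A \<in> diags C" by (simp add: D_simps)
  show ?case unfolding D_simps
    by (rule Hom_DI[OF A A diags_Obj[OF A, THEN Ide_Hom]])
      (simp_all add: diags_Hom[OF A, THEN Ide_left] diags_Hom[OF A, THEN Ide_right])
next
  case (4 f X Y g Z)
  note f = 4(1) and g = 4(2)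
  note X = Hom_D_diags(1)[OF f] and Y = Hom_D_diags(1)[OF g] and Z = Hom_D_diags(2)[OF g]
  show ?case unfolding D_simps Hom_D_src[OF f] Hom_D_trg[OF g]
    by (rule Hom_DI[OF X Z Comp_Hom[OF Hom_D_m0[OF f] Hom_D_m0[OF g]]
          Comp_Hom[OF Hom_D_m1[OF f] Hom_D_m1[OF g]] Comp_Hom[OF Hom_D_m2[OF f] Hom_D_m2[OF g]]
          square_Comp[OF diags_Hom(1)[OF X] diags_Hom(1)[OF Y] diags_Hom(1)[OF Z] Hom_D_m0[OF f]
            Hom_D_m1[OF f] Hom_D_sq0[OF f] Hom_D_m0[OF g] Hom_D_m1[OF g] Hom_D_sq0[OF g]]
          square_Comp[OF diags_Hom(2)[OF X] diags_Hom(2)[OF Y] diags_Hom(2)[OF Z] Hom_D_m1[OF f]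
            Hom_D_m2[OF f] Hom_D_sq1[OF f] Hom_D_m1[OF g] Hom_D_m2[OF g] Hom_D_sq1[OF g]]])
next
  case (5 f X Y)
  show ?case by (rule diag_mor.expand)
      (simp add: D_simps Hom_D_src[OF 5] Hom_D_trg[OF 5] Hom_D_m[OF 5, THEN Ide_left])
next
  case (6 f X Y)
  show ?case by (rule diag_mor.expand)
      (simp add: D_simps Hom_D_src[OF 6] Hom_D_trg[OF 6] Hom_D_m[OF 6, THEN Ide_right])
next
  case (7 f W X g Y h Z)
  note c = Comp_assoc[OF Hom_D_m0[OF 7(1)] Hom_D_m0[OF 7(2)] Hom_D_m0[OF 7(3)]]
    Comp_assoc[OF Hom_D_m1[OF 7(1)] Hom_D_m1[OF 7(2)] Hom_D_m1[OF 7(3)]]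
    Comp_assoc[OF Hom_D_m2[OF 7(1)] Hom_D_m2[OF 7(2)] Hom_D_m2[OF 7(3)]]
  show ?case by (simp add: D_simps c)
next
  case (8 A B)
  then have A: "A \<in> diags C" and B: "B \<in> diags C" by (simp_all add: D_simps)
  show ?case unfolding D_simps
    by (rule Hom_DI[OF A B Zero_Hom[OF diags_Obj(1)[OF A] diags_Obj(1)[OF B]]
          Zero_Hom[OF diags_Obj(2)[OF A] diags_Obj(2)[OF B]]
          Zero_Hom[OF diags_Obj(3)[OF A] diags_Obj(3)[OF B]]])
      (simp_all add: Comp_Zero_left[OF diags_Hom(1)[OF B] diags_Obj(1)[OF A]]
        Comp_Zero_left[OF diags_Hom(2)[OF B] diags_Obj(2)[OF A]]
        Comp_Zero_right[OF diags_Hom(1)[OF A] diags_Obj(2)[OF B]]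
        Comp_Zero_right[OF diags_Hom(2)[OF A] diags_Obj(3)[OF B]])
next
  case (9 f A B g)
  note f = 9(1) and g = 9(2)
  note A = Hom_D_diags(1)[OF f] and B = Hom_D_diags(2)[OF f]
  show ?case unfolding D_simps Hom_D_src[OF f] Hom_D_trg[OF f]
    by (rule Hom_DI[OF A B Add_Hom[OF Hom_D_m0[OF f] Hom_D_m0[OF g]]
          Add_Hom[OF Hom_D_m1[OF f] Hom_D_m1[OF g]] Add_Hom[OF Hom_D_m2[OF f] Hom_D_m2[OF g]]])
      (simp_all add: Comp_Add_right[OF diags_Hom(1)[OF A] Hom_D_m1[OF f] Hom_D_m1[OF g]]
        Comp_Add_right[OF diags_Hom(2)[OF A] Hom_D_m2[OF f] Hom_D_m2[OF g]]
        Comp_Add_left[OF Hom_D_m0[OF f] Hom_D_m0[OF g] diags_Hom(1)[OF B]]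
        Comp_Add_left[OF Hom_D_m1[OF f] Hom_D_m1[OF g] diags_Hom(2)[OF B]]
        Hom_D_sq0[OF f] Hom_D_sq0[OF g] Hom_D_sq1[OF f] Hom_D_sq1[OF g])
next
  case (10 f A B)
  note f = 10
  note A = Hom_D_diags(1)[OF f] and B = Hom_D_diags(2)[OF f]
  show ?case unfolding D_simps Hom_D_src[OF f] Hom_D_trg[OF f]
    by (rule Hom_DI[OF A B Hom_D_m[OF f, THEN Neg_Hom]])
      (simp_all add: Comp_Neg_right[OF diags_Hom(1)[OF A] Hom_D_m1[OF f]]
        Comp_Neg_right[OF diags_Hom(2)[OF A] Hom_D_m2[OF f]]
        Comp_Neg_left[OF Hom_D_m0[OF f] diags_Hom(1)[OF B]]
        Comp_Neg_left[OF Hom_D_m1[OF f] diags_Hom(2)[OF B]] Hom_D_sq0[OF f] Hom_D_sq1[OF f])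
next
  case (11 f A B g h)
  note c = Add_assoc[OF Hom_D_m0[OF 11(1)] Hom_D_m0[OF 11(2)] Hom_D_m0[OF 11(3)]]
    Add_assoc[OF Hom_D_m1[OF 11(1)] Hom_D_m1[OF 11(2)] Hom_D_m1[OF 11(3)]]
    Add_assoc[OF Hom_D_m2[OF 11(1)] Hom_D_m2[OF 11(2)] Hom_D_m2[OF 11(3)]]
  show ?case by (simp add: D_simps c)
next
  case (12 f A B g)
  show ?case unfolding D_simps Add_commute[OF Hom_D_m0[OF 12(1)] Hom_D_m0[OF 12(2)]]
      Add_commute[OF Hom_D_m1[OF 12(1)] Hom_D_m1[OF 12(2)]]
      Add_commute[OF Hom_D_m2[OF 12(1)] Hom_D_m2[OF 12(2)]]
      Hom_D_src[OF 12(1)] Hom_D_trg[OF 12(1)] Hom_D_src[OF 12(2)] Hom_D_trg[OF 12(2)] ..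
next
  case (13 f A B)
  show ?case by (rule diag_mor.expand)
      (simp add: D_simps Hom_D_src[OF 13] Hom_D_trg[OF 13] Hom_D_m[OF 13, THEN Add_Zero])
next
  case (14 f A B)
  show ?case
    by (simp add: D_simps Hom_D_src[OF 14] Hom_D_trg[OF 14] Hom_D_m[OF 14, THEN Add_Neg])
next
  case (15 f X Y f' g Z)
  note c = Comp_Add_left[OF Hom_D_m0[OF 15(1)] Hom_D_m0[OF 15(2)] Hom_D_m0[OF 15(3)]]
    Comp_Add_left[OF Hom_D_m1[OF 15(1)] Hom_D_m1[OF 15(2)] Hom_D_m1[OF 15(3)]]
    Comp_Add_left[OF Hom_D_m2[OF 15(1)] Hom_D_m2[OF 15(2)] Hom_D_m2[OF 15(3)]]
  show ?case by (simp add: D_simps c)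
next
  case (16 f X Y g Z g')
  note c = Comp_Add_right[OF Hom_D_m0[OF 16(1)] Hom_D_m0[OF 16(2)] Hom_D_m0[OF 16(3)]]
    Comp_Add_right[OF Hom_D_m1[OF 16(1)] Hom_D_m1[OF 16(2)] Hom_D_m1[OF 16(3)]]
    Comp_Add_right[OF Hom_D_m2[OF 16(1)] Hom_D_m2[OF 16(2)] Hom_D_m2[OF 16(3)]]
  show ?case by (simp add: D_simps c)
qed

lemma null_homotopicI:
  assumes "f \<in> Hom (diag_category C) A B" "s \<in> Hom C (ob1 C A) (ob0 C B)" "t \<in> Hom C (ob2 C A) (ob1 C B)"
    and "s \<cdot> d0 B \<oplus> d1 A \<cdot> t = m1 f"
  shows "f \<in> null_homotopic C"
  using assms by (auto simp: null_homotopic_def Hom_def[of "diag_category C"] D_simps)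

lemma null_homotopicE:
  assumes "f \<in> null_homotopic C"
  obtains s t where "f \<in> Hom (diag_category C) (src f) (trg f)"
    and "s \<in> Hom C (ob1 C (src f)) (ob0 C (trg f))" "t \<in> Hom C (ob2 C (src f)) (ob1 C (trg f))"
    and "s \<cdot> d0 (trg f) \<oplus> d1 (src f) \<cdot> t = m1 f"
  using assms by (auto simp: null_homotopic_def Hom_def[of "diag_category C"] D_simps)

lemma ideal_null_homotopic: "is_ideal (diag_category C) (null_homotopic C)"
  unfolding is_ideal_def
proof (intro conjI ballI allI impI)
  interpret D: preadditive_category "diag_category C" by (rule preadditive_D)
  show "null_homotopic C \<subseteq> Arr (diag_category C)" by (auto simp: null_homotopic_def)
  {
    fix A B assume "A \<in> Obj (diag_category C)" "B \<in> Obj (diag_category C)"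
    then have A: "A \<in> diags C" and B: "B \<in> diags C" and z: "Zero (diag_category C) A B \<in> Hom (diag_category C) A B"
      using D.Zero_Hom by (simp_all add: D_simps)
    note s = Zero_Hom[OF diags_Obj(2)[OF A] diags_Obj(1)[OF B]]
      and t = Zero_Hom[OF diags_Obj(3)[OF A] diags_Obj(2)[OF B]]
    show "Zero (diag_category C) A B \<in> null_homotopic C"
      by (rule null_homotopicI[OF z s t])
        (simp add: D_simps Comp_Zero_left[OF diags_Hom(1)[OF B] diags_Obj(2)[OF A]]
          Comp_Zero_right[OF diags_Hom(2)[OF A] diags_Obj(2)[OF B]]
          Add_Zero[OF Zero_Hom[OF diags_Obj(2)[OF A] diags_Obj(2)[OF B]]])
  next
    fix A B f g
    assume "f \<in> null_homotopic C \<inter> Hom (diag_category C) A B" "g \<in> null_homotopic C \<inter> Hom (diag_category C) A B"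
    then have f: "f \<in> Hom (diag_category C) A B" "f \<in> null_homotopic C" and g: "g \<in> Hom (diag_category C) A B" "g \<in> null_homotopic C"
      by simp_all
    have e: "src f = A" "trg f = B" "src g = A" "trg g = B" and A: "A \<in> diags C" and B: "B \<in> diags C"
      using f(1) g(1) by (simp_all add: Hom_D)
    from f(2) obtain s t where st: "s \<in> Hom C (ob1 C A) (ob0 C B)" "t \<in> Hom C (ob2 C A) (ob1 C B)"
      "s \<cdot> d0 B \<oplus> d1 A \<cdot> t = m1 f" by (rule null_homotopicE) (simp add: e)
    from g(2) obtain s' t' where st': "s' \<in> Hom C (ob1 C A) (ob0 C B)" "t' \<in> Hom C (ob2 C A) (ob1 C B)"
      "s' \<cdot> d0 B \<oplus> d1 A \<cdot> t' = m1 g" by (rule null_homotopicE) (simp add: e)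
    note sb = Comp_Hom[OF st(1) diags_Hom(1)[OF B]] and sb' = Comp_Hom[OF st'(1) diags_Hom(1)[OF B]]
      and at = Comp_Hom[OF diags_Hom(2)[OF A] st(2)] and at' = Comp_Hom[OF diags_Hom(2)[OF A] st'(2)]
    have "(s \<oplus> s') \<cdot> d0 B \<oplus> d1 A \<cdot> (t \<oplus> t') =
        s \<cdot> d0 B \<oplus> s' \<cdot> d0 B \<oplus> (d1 A \<cdot> t \<oplus> d1 A \<cdot> t')"
      using Comp_Add_left[OF st(1) st'(1) diags_Hom(1)[OF B]]
        Comp_Add_right[OF diags_Hom(2)[OF A] st(2) st'(2)] by simp
    also have "\<dots> = m1 f \<oplus> m1 g"
      unfolding st(3)[symmetric] st'(3)[symmetric]
        Add_assoc[OF sb sb' Add_Hom[OF at at']] Add_assoc[OF sb at Add_Hom[OF sb' at']]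
        Add_left_commute[OF sb' at at'] ..
    finally show "Add (diag_category C) f g \<in> null_homotopic C"
      by (intro null_homotopicI[OF D.Add_Hom[OF f(1) g(1)] Add_Hom[OF st(1) st'(1)]
            Add_Hom[OF st(2) st'(2)]]) (simp add: D_simps)
  next
    fix f assume "f \<in> null_homotopic C"
    then obtain s t where f: "f \<in> Hom (diag_category C) (src f) (trg f)"
      and st: "s \<in> Hom C (ob1 C (src f)) (ob0 C (trg f))" "t \<in> Hom C (ob2 C (src f)) (ob1 C (trg f))"
      "s \<cdot> d0 (trg f) \<oplus> d1 (src f) \<cdot> t = m1 f" by (rule null_homotopicE)
    have A: "src f \<in> diags C" and B: "trg f \<in> diags C" using f by (simp_all add: Hom_D)
    show "Neg (diag_category C) f \<in> null_homotopic C"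
      by (rule null_homotopicI[OF D.Neg_Hom[OF f] Neg_Hom[OF st(1)] Neg_Hom[OF st(2)]])
        (simp add: D_simps Comp_Neg_left[OF st(1) diags_Hom(1)[OF B]]
          Comp_Neg_right[OF diags_Hom(2)[OF A] st(2)] st(3)[symmetric]
          Neg_distrib[OF Comp_Hom[OF st(1) diags_Hom(1)[OF B]] Comp_Hom[OF diags_Hom(2)[OF A] st(2)]])
  next
    fix f g assume "f \<in> null_homotopic C" "g \<in> Arr (diag_category C)" "Cod (diag_category C) f = Dom (diag_category C) g"
    then obtain s t where f: "f \<in> Hom (diag_category C) (src f) (src g)"
      and st: "s \<in> Hom C (ob1 C (src f)) (ob0 C (src g))" "t \<in> Hom C (ob2 C (src f)) (ob1 C (src g))"
      "s \<cdot> d0 (src g) \<oplus> d1 (src f) \<cdot> t = m1 f" and g: "g \<in> Hom (diag_category C) (src g) (trg g)"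
      by (auto elim!: null_homotopicE simp: Hom_def[of "diag_category C"] D_simps)
    have A: "src f \<in> diags C" and B: "src g \<in> diags C" and Z: "trg g \<in> diags C"
      and g0: "m0 g \<in> Hom C (ob0 C (src g)) (ob0 C (trg g))"
      and g1: "m1 g \<in> Hom C (ob1 C (src g)) (ob1 C (trg g))"
      and sq: "d0 (src g) \<cdot> m1 g = m0 g \<cdot> d0 (trg g)"
      using f g by (simp_all add: Hom_D)
    have "s \<cdot> m0 g \<cdot> d0 (trg g) \<oplus> d1 (src f) \<cdot> (t \<cdot> m1 g) = m1 f \<cdot> m1 g"
      unfolding st(3)[symmetric] Comp_Add_left[OF Comp_Hom[OF st(1) diags_Hom(1)[OF B]]
          Comp_Hom[OF diags_Hom(2)[OF A] st(2)] g1]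
        Comp_assoc[OF st(1) g0 diags_Hom(1)[OF Z]] Comp_assoc[OF st(1) diags_Hom(1)[OF B] g1]
        Comp_assoc[OF diags_Hom(2)[OF A] st(2) g1] sq ..
    then show "Comp (diag_category C) f g \<in> null_homotopic C"
      by (intro null_homotopicI[OF D.Comp_Hom[OF f g] Comp_Hom[OF st(1) g0] Comp_Hom[OF st(2) g1]])
        (simp add: D_simps)
  next
    fix f g assume "f \<in> Arr (diag_category C)" "g \<in> null_homotopic C" "Cod (diag_category C) f = Dom (diag_category C) g"
    then obtain s t where g: "g \<in> Hom (diag_category C) (trg f) (trg g)"
      and st: "s \<in> Hom C (ob1 C (trg f)) (ob0 C (trg g))" "t \<in> Hom C (ob2 C (trg f)) (ob1 C (trg g))"
      "s \<cdot> d0 (trg g) \<oplus> d1 (trg f) \<cdot> t = m1 g" and f: "f \<in> Hom (diag_category C) (src f) (trg f)"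
      by (auto elim!: null_homotopicE simp: Hom_def[of "diag_category C"] D_simps)
    have A: "src f \<in> diags C" and B: "trg f \<in> diags C" and Z: "trg g \<in> diags C"
      and f1: "m1 f \<in> Hom C (ob1 C (src f)) (ob1 C (trg f))"
      and f2: "m2 f \<in> Hom C (ob2 C (src f)) (ob2 C (trg f))"
      and sq: "d1 (src f) \<cdot> m2 f = m1 f \<cdot> d1 (trg f)"
      using f g by (simp_all add: Hom_D)
    have "m1 f \<cdot> s \<cdot> d0 (trg g) \<oplus> d1 (src f) \<cdot> (m2 f \<cdot> t) = m1 f \<cdot> m1 g"
      unfolding st(3)[symmetric] Comp_Add_right[OF f1 Comp_Hom[OF st(1) diags_Hom(1)[OF Z]]
          Comp_Hom[OF diags_Hom(2)[OF B] st(2)]]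
        Comp_assoc[OF f1 st(1) diags_Hom(1)[OF Z]] Comp_assoc[OF f1 diags_Hom(2)[OF B] st(2), symmetric]
        Comp_assoc[OF diags_Hom(2)[OF A] f2 st(2), symmetric] sq ..
    then show "Comp (diag_category C) f g \<in> null_homotopic C"
      by (intro null_homotopicI[OF D.Comp_Hom[OF f g] Comp_Hom[OF f1 st(1)] Comp_Hom[OF f2 st(2)]])
        (simp add: D_simps)
  }
qed

theorem preadditive_Adel: "preadditive_category (Adel C)"
proof -
  interpret Q: preadditive_quotient "diag_category C" "null_homotopic C"
    by (intro preadditive_quotient.intro preadditive_quotient_axioms.intro preadditive_D
        ideal_null_homotopic)
  show ?thesis unfolding Adel_def by (rule Q.preadditive_Q)
qed

end

context additive_category
begin

lemma is_direct_sum_single: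
  assumes A: "A \<in> Obj C"
  shows "is_direct_sum C [A] A (\<lambda>_. \<one> A) (\<lambda>_. \<one> A)"
  using A Ide_Hom[OF A] Ide_left[OF Ide_Hom[OF A]] Add_Zero[OF Ide_Hom[OF A]]
  by (simp add: is_direct_sum_def hom_sum_def)

theorem ex_direct_sum_choice: "\<exists>ds :: ('a, 'b) dsums. direct_sum_choice C ds"
proof -
  have "\<forall>As. \<exists>d. (set As \<subseteq> Obj C \<longrightarrow> is_direct_sum C As (fst d) (fst (snd d)) (snd (snd d))) \<and>
      (\<forall>A \<in> Obj C. As = [A] \<longrightarrow> d = (A, \<lambda>_. \<one> A, \<lambda>_. \<one> A))"
  proof
    fix As
    show "\<exists>d. (set As \<subseteq> Obj C \<longrightarrow> is_direct_sum C As (fst d) (fst (snd d)) (snd (snd d))) \<and>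
      (\<forall>A \<in> Obj C. As = [A] \<longrightarrow> d = (A, \<lambda>_. \<one> A, \<lambda>_. \<one> A))"
    proof (cases "\<exists>A \<in> Obj C. As = [A]")
      case True
      then obtain A where A: "A \<in> Obj C" "As = [A]" by blast
      show ?thesis
        by (rule exI[of _ "(A, \<lambda>_. \<one> A, \<lambda>_. \<one> A)"]) (simp add: A is_direct_sum_single)
    next
      case False
      show ?thesis
      proof (cases "set As \<subseteq> Obj C")
        case True
        then obtain S \<iota> \<pi> where "is_direct_sum C As S \<iota> \<pi>" using ex_direct_sum by blast
        then show ?thesis using False by (intro exI[of _ "(S, \<iota>, \<pi>)"]) auto
      qed (use False in auto)
    qed
  qed
  then obtain d where d: "\<And>As. set As \<subseteq> Obj C \<Longrightarrow>
      is_direct_sum C As (fst (d As)) (fst (snd (d As))) (snd (snd (d As)))"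
    and d1: "\<And>A. A \<in> Obj C \<Longrightarrow> d [A] = (A, \<lambda>_. \<one> A, \<lambda>_. \<one> A)"
    by metis
  have "direct_sum_choice C
      \<lparr>dsum = \<lambda>As. fst (d As), dinj = \<lambda>As. fst (snd (d As)), dproj = \<lambda>As. snd (snd (d As))\<rparr>"
    using d d1 by (simp add: direct_sum_choice_def)
  then show ?thesis by blast
qed

end

end

(* A morphism of diagrams vanishes in the Adelman category exactly if it has a null-homotopy (s, w).
   For a test morphism t with t f = 0, the two components of such a null-homotopy are precisely the
   additional columns needed to lift t to K, and the lift commutes with the projection already on the
   level of diagrams; conversely, a null-homotopy of u k, completed by the remaining component of u,
   is a null-homotopy of u, so that the projection is a monomorphism. The other three universal
   properties follow the same pattern. The given map J -> I composes with the projections to f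
   itself, and the two composites with its inverse differ from the identities by explicit
   null-homotopies. *)
theory Submission
  imports Defs
begin

text \<open>\<open>K\<close> is the null-homotopy equation turned into a diagram. For a test
  morphism with components t0, t1, t2 and extra columns s, w, the second square of the lift with
  middle row (t1, s) and last row (t2, w) says d1 w = t1 f1 - s b0; this is where the entries f1 and
  -b0 come from. The identity on B0 in the first arrow has two effects: it forces the remaining
  column to be d0 s, and every component into B0 factors through it, so a null-homotopy can always
  absorb such a component. The cokernel object is the dual construction. \<open>J\<close> is that
  construction applied to K -> A, and \<open>I\<close> is the kernel construction applied to B -> C,
  but with threefold sums in place of nested ones such as A0 + (A1 + B0). The chosen sums for these
  two shapes may be different objects, so the statements on \<open>J\<close> and \<open>I\<close>
  are not literal instances of those on the cokernel and the kernel; they are proved again, with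
  each null-homotopy split into its entries.\<close>

context preadditive_category
begin

section \<open>Finite sums of parallel morphisms\<close>

lemma hom_sum_Nil [simp]: "hom_sum C A B [] = \<zero> A B"
  and hom_sum_Cons [simp]: "hom_sum C A B (f # fs) = f \<oplus> hom_sum C A B fs"
  by (simp_all add: hom_sum_def)

lemma hom_sum_Hom:
  assumes "A \<in> Obj C" "B \<in> Obj C" "set fs \<subseteq> Hom C A B"
  shows "hom_sum C A B fs \<in> Hom C A B"
  using assms(3) by (induction fs) (simp_all add: Zero_Hom[OF assms(1,2)] Add_Hom)

lemma hom_sum_append:
  assumes "A \<in> Obj C" "B \<in> Obj C" "set fs \<subseteq> Hom C A B" "set gs \<subseteq> Hom C A B"
  shows "hom_sum C A B (fs @ gs) = hom_sum C A B fs \<oplus> hom_sum C A B gs"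
  using assms(3)
proof (induction fs)
  case Nil
  then show ?case using hom_sum_Hom[OF assms(1,2,4)] by (simp add: Zero_Add)
next
  case (Cons f fs)
  then show ?case
    using Add_assoc[OF _ hom_sum_Hom[OF assms(1,2)] hom_sum_Hom[OF assms(1,2,4)]] by simp
qed

text \<open>Since \<open>matrix\<close> adds its summands along one flattened list, regrouping is
  needed to treat it row by row.\<close>

lemma hom_sum_concat:
  assumes "A \<in> Obj C" "B \<in> Obj C" "\<And>fs. fs \<in> set fss \<Longrightarrow> set fs \<subseteq> Hom C A B"
  shows "hom_sum C A B (concat fss) = hom_sum C A B (map (hom_sum C A B) fss)"
  using assms(3)
proof (induction fss)
  case (Cons fs fss)
  have "set (concat fss) \<subseteq> Hom C A B" using Cons.prems by auto
  then show ?case using Cons hom_sum_append[OF assms(1,2), of fs "concat fss"] by simp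
qed simp

lemma Comp_hom_sum_right:
  assumes f: "f \<in> Hom C X A" and B: "B \<in> Obj C" and fs: "set fs \<subseteq> Hom C A B"
  shows "f \<cdot> hom_sum C A B fs = hom_sum C X B (map (\<lambda>g. f \<cdot> g) fs)"
  using fs
proof (induction fs)
  case (Cons g fs)
  then show ?case
    using Comp_Add_right[OF f _ hom_sum_Hom[OF Hom_Obj(2)[OF f] B]] by simp
qed (simp add: Comp_Zero_right[OF f B])

lemma Comp_hom_sum_left:
  assumes f: "f \<in> Hom C B Y" and A: "A \<in> Obj C" and fs: "set fs \<subseteq> Hom C A B"
  shows "hom_sum C A B fs \<cdot> f = hom_sum C A Y (map (\<lambda>g. g \<cdot> f) fs)"
  using fs
proof (induction fs)
  case (Cons g fs)
  then show ?case
    using Comp_Add_left[OF _ hom_sum_Hom[OF A Hom_Obj(1)[OF f]] f] by simp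
qed (simp add: Comp_Zero_left[OF f A])

lemma Comp_hom_sum_Comp:
  assumes f: "f \<in> Hom C X A" and g: "g \<in> Hom C B Y" and fs: "set fs \<subseteq> Hom C A B"
  shows "f \<cdot> hom_sum C A B fs \<cdot> g = hom_sum C X Y (map (\<lambda>x. f \<cdot> x \<cdot> g) fs)"
proof -
  have "set (map (\<lambda>x. f \<cdot> x) fs) \<subseteq> Hom C X B" using fs Comp_Hom[OF f] by auto
  from Comp_hom_sum_left[OF g Hom_Obj(1)[OF f] this] show ?thesis
    by (simp add: Comp_hom_sum_right[OF f Hom_Obj(1)[OF g] fs] o_def)
qed

lemma hom_sum_delta:
  assumes x: "x \<in> Hom C A B" and "k < n"
  shows "hom_sum C A B (map (\<lambda>j. if j = k then x else \<zero> A B) [0..<n]) = x"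
proof -
  note AB = Hom_Obj[OF x]
  have *: "hom_sum C A B (map (\<lambda>j. if j = k then x else \<zero> A B) [0..<m]) = (if k < m then x else \<zero> A B)" for m
  proof (induction m)
    case (Suc m)
    have "hom_sum C A B (map (\<lambda>j. if j = k then x else \<zero> A B) [0..<Suc m]) =
        (if k < m then x else \<zero> A B) \<oplus> hom_sum C A B [if m = k then x else \<zero> A B]"
      unfolding Suc.IH[symmetric]
      by (subst hom_sum_append[OF AB, symmetric]) (auto simp: x Zero_Hom[OF AB])
    also have "\<dots> = (if k < Suc m then x else \<zero> A B)"
      by (auto simp: Add_Zero[OF x] Zero_Add[OF x] Add_Zero[OF Zero_Hom[OF AB]])
    finally show ?case .
  qed simp
  show ?thesis using * assms(2) by simp
qed

end

section \<open>Matrices over a choice of direct sums\<close>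

text \<open>Typing and shape in one predicate: \<open>list_all2\<close> also fixes the numbers of
  rows and columns, and on literal matrices it unfolds to a conjunction of typing facts.\<close>

definition hom_matrix :: "('o, 'm, 'e) precat_scheme \<Rightarrow> 'o list \<Rightarrow> 'o list \<Rightarrow> 'm list list \<Rightarrow> bool"
  where "hom_matrix C As Bs M \<longleftrightarrow> list_all2 (\<lambda>A. list_all2 (\<lambda>B m. m \<in> Hom C A B) Bs) As M"

text \<open>Products and sums of matrices are stated through this table of values; for literal lists
  of objects it evaluates to a literal matrix.\<close>

definition mat_of :: "nat \<Rightarrow> nat \<Rightarrow> (nat \<Rightarrow> nat \<Rightarrow> 'm) \<Rightarrow> 'm list list"
  where "mat_of m n F = map (\<lambda>k. map (F k) [0..<n]) [0..<m]"

lemma hom_matrix_nth: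
  assumes "hom_matrix C As Bs M" "k < length As" "l < length Bs"
  shows "M ! k ! l \<in> Hom C (As ! k) (Bs ! l)"
  using assms unfolding hom_matrix_def by (metis list_all2_nthD)

lemma hom_matrix_mat_of:
  assumes "\<And>k l. k < length As \<Longrightarrow> l < length Bs \<Longrightarrow> F k l \<in> Hom C (As ! k) (Bs ! l)"
  shows "hom_matrix C As Bs (mat_of (length As) (length Bs) F)"
  using assms unfolding hom_matrix_def mat_of_def by (auto simp: list_all2_conv_all_nth)

lemma mat_of_nth [simp]: "k < m \<Longrightarrow> l < n \<Longrightarrow> mat_of m n F ! k ! l = F k l"
  by (simp add: mat_of_def)

locale direct_sum_category = preadditive_category +
  fixes ds :: "('a, 'b) dsums"
  assumes sums: "direct_sum_choice C ds"
begin

abbreviation "mat \<equiv> matrix C ds"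
abbreviation "sm \<equiv> dsum ds"
abbreviation "inc \<equiv> dinj ds"
abbreviation "prj \<equiv> dproj ds"
abbreviation "hmat \<equiv> hom_matrix C"

lemma dsum_facts:
  assumes "set As \<subseteq> Obj C"
  shows dsum_Obj: "sm As \<in> Obj C"
    and inc_Hom: "k < length As \<Longrightarrow> inc As k \<in> Hom C (As ! k) (sm As)"
    and prj_Hom: "k < length As \<Longrightarrow> prj As k \<in> Hom C (sm As) (As ! k)"
    and inc_prj: "k < length As \<Longrightarrow> l < length As \<Longrightarrow>
      inc As k \<cdot> prj As l = (if k = l then \<one> (As ! k) else \<zero> (As ! k) (As ! l))"
    and sum_prj_inc: "hom_sum C (sm As) (sm As) (map (\<lambda>k. prj As k \<cdot> inc As k) [0..<length As]) = \<one> (sm As)"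
  using sums assms by (auto simp: direct_sum_choice_def is_direct_sum_def)

lemma dsum_single:
  assumes "A \<in> Obj C"
  shows "sm [A] = A" "inc [A] 0 = \<one> A" "prj [A] 0 = \<one> A"
  using sums assms by (auto simp: direct_sum_choice_def)

context
  fixes As Bs
  assumes As: "set As \<subseteq> Obj C" and Bs: "set Bs \<subseteq> Obj C"
begin

lemma matrix_summand_Hom:
  assumes "hmat As Bs M" "k < length As" "l < length Bs"
  shows "prj As k \<cdot> (M ! k ! l) \<cdot> inc Bs l \<in> Hom C (sm As) (sm Bs)"
  by (rule Comp_Hom[OF Comp_Hom[OF prj_Hom[OF As] hom_matrix_nth] inc_Hom[OF Bs]]) (use assms in simp_all)

lemma matrix_eq_sums:
  assumes "hmat As Bs M"
  shows "mat As Bs M = hom_sum C (sm As) (sm Bs) (map (\<lambda>k. hom_sum C (sm As) (sm Bs)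
    (map (\<lambda>l. prj As k \<cdot> (M ! k ! l) \<cdot> inc Bs l) [0..<length Bs])) [0..<length As])"
  unfolding matrix_def
  by (subst hom_sum_concat[OF dsum_Obj[OF As] dsum_Obj[OF Bs]])
    (auto simp: o_def matrix_summand_Hom[OF assms])

lemma matrix_Hom:
  assumes "hmat As Bs M"
  shows "mat As Bs M \<in> Hom C (sm As) (sm Bs)"
  unfolding matrix_eq_sums[OF assms]
  by (intro hom_sum_Hom[OF dsum_Obj[OF As] dsum_Obj[OF Bs]])
    (auto intro!: hom_sum_Hom[OF dsum_Obj[OF As] dsum_Obj[OF Bs]] matrix_summand_Hom[OF assms])

lemma matrix_cong:
  assumes "\<And>k l. k < length As \<Longrightarrow> l < length Bs \<Longrightarrow> M ! k ! l = N ! k ! l"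
  shows "mat As Bs M = mat As Bs N"
  unfolding matrix_def
  by (rule arg_cong[of _ _ "hom_sum C (sm As) (sm Bs)"], rule arg_cong[of _ _ concat])
    (simp add: assms)

text \<open>The identities of \<open>sm As\<close> and \<open>sm Bs\<close> are the sums of
  \<open>prj \<cdot> inc\<close>. Inserting them on both sides of \<open>x\<close> expands it into
  the summands of its matrix.\<close>

lemma matrix_entries:
  assumes x: "x \<in> Hom C (sm As) (sm Bs)"
  shows "mat As Bs (mat_of (length As) (length Bs) (\<lambda>k l. inc As k \<cdot> x \<cdot> prj Bs l)) = x"
proof -
  let ?m = "length As" and ?n = "length Bs"
  let ?M = "mat_of ?m ?n (\<lambda>k l. inc As k \<cdot> x \<cdot> prj Bs l)"
  note A = dsum_Obj[OF As] and B = dsum_Obj[OF Bs]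
  have e: "inc As k \<cdot> x \<cdot> prj Bs l \<in> Hom C (As ! k) (Bs ! l)" if "k < ?m" "l < ?n" for k l
    using Comp_Hom[OF Comp_Hom[OF inc_Hom[OF As] x] prj_Hom[OF Bs]] that by blast
  have px: "prj As k \<cdot> inc As k \<cdot> x \<in> Hom C (sm As) (sm Bs)" if "k < ?m" for k
    using Comp_Hom[OF Comp_Hom[OF prj_Hom[OF As that] inc_Hom[OF As that]] x] .
  have M: "hmat As Bs ?M" by (rule hom_matrix_mat_of) (rule e)
  have row: "hom_sum C (sm As) (sm Bs) (map (\<lambda>l. prj As k \<cdot> (?M ! k ! l) \<cdot> inc Bs l) [0..<?n]) =
      prj As k \<cdot> inc As k \<cdot> x" if k: "k < ?m" for k
  proof -
    have 1: "prj As k \<cdot> (inc As k \<cdot> x \<cdot> prj Bs l) \<cdot> inc Bs l =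
        prj As k \<cdot> inc As k \<cdot> x \<cdot> (prj Bs l \<cdot> inc Bs l)" if l: "l < ?n" for l
    proof -
      note p = prj_Hom[OF As k] and i = inc_Hom[OF As k] and p' = prj_Hom[OF Bs l] and i' = inc_Hom[OF Bs l]
      show ?thesis
        using Comp_assoc[OF p Comp_Hom[OF i x] p'] Comp_assoc[OF p i x] Comp_assoc[OF px[OF k] p' i']
        by simp
    qed
    have "hom_sum C (sm As) (sm Bs) (map (\<lambda>l. prj As k \<cdot> (?M ! k ! l) \<cdot> inc Bs l) [0..<?n]) =
      hom_sum C (sm As) (sm Bs) (map (\<lambda>l. prj As k \<cdot> inc As k \<cdot> x \<cdot> (prj Bs l \<cdot> inc Bs l)) [0..<?n])"
      by (rule arg_cong[of _ _ "hom_sum C (sm As) (sm Bs)"]) (simp add: k 1)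
    also have "\<dots> = prj As k \<cdot> inc As k \<cdot> x \<cdot> \<one> (sm Bs)"
      unfolding sum_prj_inc[OF Bs, symmetric]
      by (subst Comp_hom_sum_right[OF px[OF k] B])
        (auto intro!: Comp_Hom[OF prj_Hom[OF Bs] inc_Hom[OF Bs]] simp: o_def)
    finally show ?thesis using Ide_right[OF px[OF k]] by simp
  qed
  have "mat As Bs ?M = hom_sum C (sm As) (sm Bs) (map (\<lambda>k. prj As k \<cdot> inc As k \<cdot> x) [0..<?m])"
    unfolding matrix_eq_sums[OF M]
    by (rule arg_cong[of _ _ "hom_sum C (sm As) (sm Bs)"]) (simp add: row)
  also have "\<dots> = \<one> (sm As) \<cdot> x"
    unfolding sum_prj_inc[OF As, symmetric]
    by (subst Comp_hom_sum_left[OF x A])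
      (auto intro!: Comp_Hom[OF prj_Hom[OF As] inc_Hom[OF As]] simp: o_def)
  finally show ?thesis using Ide_left[OF x] by simp
qed

text \<open>By the orthogonality relations \<open>inc_prj\<close>, a single summand of the double
  sum survives between \<open>inc As k\<close> and \<open>prj Bs l\<close>.\<close>

lemma entry_matrix:
  assumes M: "hmat As Bs M" and k: "k < length As" and l: "l < length Bs"
  shows "inc As k \<cdot> mat As Bs M \<cdot> prj Bs l = M ! k ! l"
proof -
  note A = dsum_Obj[OF As] and B = dsum_Obj[OF Bs]
  let ?S = "hom_sum C (As ! k) (Bs ! l)"
  note i = inc_Hom[OF As k] and p = prj_Hom[OF Bs l]
  have Ak: "As ! k \<in> Obj C" and Bl: "Bs ! l \<in> Obj C" using As Bs k l by auto
  \<comment> \<open>The conditionals are nested with the column test outside, so that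
    \<open>hom_sum_delta\<close> first collapses the inner sum over \<open>l'\<close> and then the
    outer sum over \<open>k'\<close>.\<close>
  have summand: "inc As k \<cdot> (prj As k' \<cdot> (M ! k' ! l') \<cdot> inc Bs l') \<cdot> prj Bs l =
      (if l' = l then (if k' = k then M ! k ! l else \<zero> (As ! k) (Bs ! l)) else \<zero> (As ! k) (Bs ! l))"
    if k': "k' < length As" and l': "l' < length Bs" for k' l'
  proof -
    note m = hom_matrix_nth[OF M k' l'] and p' = prj_Hom[OF As k'] and i' = inc_Hom[OF Bs l']
    have Ak': "As ! k' \<in> Obj C" and Bl': "Bs ! l' \<in> Obj C" using As Bs k' l' by auto
    have "inc As k \<cdot> (prj As k' \<cdot> (M ! k' ! l') \<cdot> inc Bs l') \<cdot> prj Bs l =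
        inc As k \<cdot> prj As k' \<cdot> (M ! k' ! l') \<cdot> (inc Bs l' \<cdot> prj Bs l)"
      using Comp_assoc[OF i Comp_Hom[OF p' m] i'] Comp_assoc[OF i p' m]
        Comp_assoc[OF Comp_Hom[OF Comp_Hom[OF i p'] m] i' p] by simp
    then show ?thesis
      using inc_prj[OF As k k'] inc_prj[OF Bs l' l] Ide_left[OF m] Ide_right[OF m]
        Comp_Zero_left[OF m Ak] Comp_Zero_right[OF m Bl] Ide_right[OF Zero_Hom[OF Ak Bl]]
        Comp_Zero_left[OF Zero_Hom[OF Bl' Bl] Ak]
      by (cases "k' = k"; cases "l' = l") simp_all
  qed
  have z: "\<zero> (As ! k) (Bs ! l) \<in> Hom C (As ! k) (Bs ! l)" using Zero_Hom[OF Ak Bl] .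
  have h: "hom_sum C (sm As) (sm Bs) (map (\<lambda>l'. prj As k' \<cdot> (M ! k' ! l') \<cdot> inc Bs l') [0..<length Bs])
      \<in> Hom C (sm As) (sm Bs)" if "k' < length As" for k'
    by (intro hom_sum_Hom[OF A B]) (auto intro!: matrix_summand_Hom[OF M] that)
  have row: "inc As k \<cdot> hom_sum C (sm As) (sm Bs)
        (map (\<lambda>l'. prj As k' \<cdot> (M ! k' ! l') \<cdot> inc Bs l') [0..<length Bs]) \<cdot> prj Bs l =
      (if k' = k then M ! k ! l else \<zero> (As ! k) (Bs ! l))" if k': "k' < length As" for k'
  proof -
    have "inc As k \<cdot> hom_sum C (sm As) (sm Bs)
        (map (\<lambda>l'. prj As k' \<cdot> (M ! k' ! l') \<cdot> inc Bs l') [0..<length Bs]) \<cdot> prj Bs l =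
      ?S (map (\<lambda>l'. inc As k \<cdot> (prj As k' \<cdot> (M ! k' ! l') \<cdot> inc Bs l') \<cdot> prj Bs l) [0..<length Bs])"
      by (subst Comp_hom_sum_Comp[OF i p]) (auto simp: o_def k' intro!: matrix_summand_Hom[OF M])
    also have "\<dots> = ?S (map (\<lambda>l'. if l' = l then (if k' = k then M ! k ! l else \<zero> (As ! k) (Bs ! l))
        else \<zero> (As ! k) (Bs ! l)) [0..<length Bs])"
      by (rule arg_cong[of _ _ ?S]) (simp add: summand[OF k'])
    finally show ?thesis using hom_sum_delta[OF _ l] hom_matrix_nth[OF M k l] z by simp
  qed
  have "inc As k \<cdot> mat As Bs M \<cdot> prj Bs l = ?S (map (\<lambda>k'. inc As k \<cdot> hom_sum C (sm As) (sm Bs)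
        (map (\<lambda>l'. prj As k' \<cdot> (M ! k' ! l') \<cdot> inc Bs l') [0..<length Bs]) \<cdot> prj Bs l) [0..<length As])"
    unfolding matrix_eq_sums[OF M]
    by (subst Comp_hom_sum_Comp[OF i p]) (auto simp: o_def h)
  also have "\<dots> = ?S (map (\<lambda>k'. if k' = k then M ! k ! l else \<zero> (As ! k) (Bs ! l)) [0..<length As])"
    by (rule arg_cong[of _ _ ?S]) (simp add: row)
  finally show ?thesis using hom_sum_delta[OF hom_matrix_nth[OF M k l] k] by simp
qed

text \<open>Identities, sums and products are all identified through this rule, which reduces each
  of them to the computation of one entry.\<close>

lemma eq_matrixI:
  assumes x: "x \<in> Hom C (sm As) (sm Bs)"
    and e: "\<And>k l. k < length As \<Longrightarrow> l < length Bs \<Longrightarrow> inc As k \<cdot> x \<cdot> prj Bs l = M ! k ! l"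
  shows "x = mat As Bs M"
  using matrix_entries[OF x] matrix_cong[of "mat_of (length As) (length Bs) (\<lambda>k l. inc As k \<cdot> x \<cdot> prj Bs l)" M] e
  by simp

lemma ex_matrix:
  assumes x: "x \<in> Hom C (sm As) (sm Bs)"
  shows "\<exists>M. hmat As Bs M \<and> x = mat As Bs M"
  by (rule exI, rule conjI[OF hom_matrix_mat_of matrix_entries[OF x, symmetric]])
    (rule Comp_Hom[OF Comp_Hom[OF inc_Hom[OF As] x] prj_Hom[OF Bs]])

lemma matrix_Add:
  assumes M: "hmat As Bs M" and N: "hmat As Bs N"
  shows "mat As Bs M \<oplus> mat As Bs N =
    mat As Bs (mat_of (length As) (length Bs) (\<lambda>k l. M ! k ! l \<oplus> N ! k ! l))"
proof (rule eq_matrixI[OF Add_Hom[OF matrix_Hom[OF M] matrix_Hom[OF N]]])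
  fix k l assume kl: "k < length As" "l < length Bs"
  note i = inc_Hom[OF As kl(1)] and p = prj_Hom[OF Bs kl(2)]
  show "inc As k \<cdot> (mat As Bs M \<oplus> mat As Bs N) \<cdot> prj Bs l =
    mat_of (length As) (length Bs) (\<lambda>k l. M ! k ! l \<oplus> N ! k ! l) ! k ! l"
    using kl entry_matrix[OF M kl] entry_matrix[OF N kl]
      Comp_Add_right[OF i matrix_Hom[OF M] matrix_Hom[OF N]]
      Comp_Add_left[OF Comp_Hom[OF i matrix_Hom[OF M]] Comp_Hom[OF i matrix_Hom[OF N]] p] by simp
qed

end

lemma Ide_matrix:
  assumes As: "set As \<subseteq> Obj C"
  shows "\<one> (sm As) = mat As As (mat_of (length As) (length As)
    (\<lambda>k l. if k = l then \<one> (As ! k) else \<zero> (As ! k) (As ! l)))"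
proof (rule eq_matrixI[OF As As Ide_Hom[OF dsum_Obj[OF As]]])
  fix k l assume kl: "k < length As" "l < length As"
  show "inc As k \<cdot> \<one> (sm As) \<cdot> prj As l = mat_of (length As) (length As)
    (\<lambda>k l. if k = l then \<one> (As ! k) else \<zero> (As ! k) (As ! l)) ! k ! l"
    using kl inc_prj[OF As kl] Ide_right[OF inc_Hom[OF As kl(1)]] by simp
qed

text \<open>Inserting the identity of \<open>sm Bs\<close>, as the sum of
  \<open>prj Bs j \<cdot> inc Bs j\<close>, between the factors cuts an entry of the composite into
  the products over the middle index \<open>j\<close>.\<close>

lemma matrix_Comp:
  assumes As: "set As \<subseteq> Obj C" and Bs: "set Bs \<subseteq> Obj C" and Cs: "set Cs \<subseteq> Obj C"
    and M: "hmat As Bs M" and N: "hmat Bs Cs N"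
  shows "mat As Bs M \<cdot> mat Bs Cs N = mat As Cs (mat_of (length As) (length Cs)
    (\<lambda>k l. hom_sum C (As ! k) (Cs ! l) (map (\<lambda>j. (M ! k ! j) \<cdot> (N ! j ! l)) [0..<length Bs])))"
proof (rule eq_matrixI[OF As Cs])
  note m = matrix_Hom[OF As Bs M] and n = matrix_Hom[OF Bs Cs N]
  show "mat As Bs M \<cdot> mat Bs Cs N \<in> Hom C (sm As) (sm Cs)" by (rule Comp_Hom[OF m n])
  fix k l assume k: "k < length As" and l: "l < length Cs"
  let ?S = "hom_sum C (As ! k) (Cs ! l)"
  have Ak: "As ! k \<in> Obj C" and Cl: "Cs ! l \<in> Obj C" using As Cs k l by auto
  note i = inc_Hom[OF As k] and p = prj_Hom[OF Cs l]
  note im = Comp_Hom[OF i m] and np = Comp_Hom[OF n p]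
  have "inc As k \<cdot> (mat As Bs M \<cdot> mat Bs Cs N) \<cdot> prj Cs l =
      inc As k \<cdot> mat As Bs M \<cdot> \<one> (sm Bs) \<cdot> (mat Bs Cs N \<cdot> prj Cs l)"
    using Comp_assoc[OF i m n] Comp_assoc[OF im n p] Ide_right[OF im] by simp
  also have "\<dots> = ?S (map (\<lambda>j. inc As k \<cdot> mat As Bs M \<cdot> (prj Bs j \<cdot> inc Bs j) \<cdot>
      (mat Bs Cs N \<cdot> prj Cs l)) [0..<length Bs])"
    unfolding sum_prj_inc[OF Bs, symmetric]
    by (subst Comp_hom_sum_Comp[OF im np])
      (auto simp: o_def intro!: Comp_Hom[OF prj_Hom[OF Bs] inc_Hom[OF Bs]])
  also have "\<dots> = ?S (map (\<lambda>j. (M ! k ! j) \<cdot> (N ! j ! l)) [0..<length Bs])"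
  proof (rule arg_cong[of _ _ ?S], rule map_cong[OF refl])
    fix j assume "j \<in> set [0..<length Bs]"
    then have j: "j < length Bs" by simp
    note q = prj_Hom[OF Bs j] and r = inc_Hom[OF Bs j]
    show "inc As k \<cdot> mat As Bs M \<cdot> (prj Bs j \<cdot> inc Bs j) \<cdot> (mat Bs Cs N \<cdot> prj Cs l) =
        (M ! k ! j) \<cdot> (N ! j ! l)"
      unfolding entry_matrix[OF As Bs M k j, symmetric] entry_matrix[OF Bs Cs N j l, symmetric]
      using Comp_assoc[OF im q r] Comp_assoc[OF Comp_Hom[OF im q] r np] Comp_assoc[OF r n p] by simp
  qed
  finally show "inc As k \<cdot> (mat As Bs M \<cdot> mat Bs Cs N) \<cdot> prj Cs l = mat_of (length As) (length Cs)
    (\<lambda>k l. hom_sum C (As ! k) (Cs ! l) (map (\<lambda>j. (M ! k ! j) \<cdot> (N ! j ! l)) [0..<length Bs])) ! k ! l"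
    using k l by simp
qed

text \<open>This rests on the convention that a single object is its own chosen sum; it lets plain
  arrows take part in matrix products.\<close>

lemma matrix_single: "x \<in> Hom C A B \<Longrightarrow> mat [A] [B] [[x]] = x"
  using Ide_left[of x A B] Ide_right[of x A B] Add_Zero[of x A B] Hom_Obj[of x A B]
  by (simp add: matrix_def dsum_single)

end

section \<open>Kernels, cokernels and induced morphisms in a preadditive category\<close>

context preadditive_category
begin

text \<open>Uniqueness of the lift is reduced, by taking differences, to a test for vanishing. This
  is the form that suits a quotient category, where vanishing means membership in the ideal.\<close>

lemma is_kernelI:
  assumes g: "g \<in> Hom C X Y" and k: "k \<in> Hom C K X" and "k \<cdot> g = \<zero> K Y"
    and ex: "\<And>T t. t \<in> Hom C T X \<Longrightarrow> t \<cdot> g = \<zero> T Y \<Longrightarrow> \<exists>u\<in>Hom C T K. u \<cdot> k = t"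
    and mono: "\<And>T u. u \<in> Hom C T K \<Longrightarrow> u \<cdot> k = \<zero> T X \<Longrightarrow> u = \<zero> T K"
  shows "is_kernel C g k"
proof -
  have "u = v" if u: "u \<in> Hom C T K" and v: "v \<in> Hom C T K" and e: "u \<cdot> k = v \<cdot> k" for T u v
  proof -
    have uv: "u \<oplus> \<ominus> v \<in> Hom C T K" using Add_Hom[OF u Neg_Hom[OF v]] .
    have "(u \<oplus> \<ominus> v) \<cdot> k = \<zero> T X"
      using Comp_Add_left[OF u Neg_Hom[OF v] k] Comp_Neg_left[OF v k] e Add_Neg[OF Comp_Hom[OF v k]]
      by simp
    then have "u \<oplus> \<ominus> v = \<zero> T K" using mono[OF uv] by simp
    then have "\<ominus> u = \<ominus> v" by (rule Neg_unique[OF u Neg_Hom[OF v]])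
    then show "u = v" using Neg_Neg[OF u] Neg_Neg[OF v] by metis
  qed
  then have "\<exists>!u. u \<in> Hom C T K \<and> u \<cdot> k = t" if "t \<in> Hom C T X" "t \<cdot> g = \<zero> T Y" for T t
    using ex[OF that] by metis
  moreover have "Dom C g = X" "Cod C g = Y" "Dom C k = K" "Cod C k = X" "g \<in> Arr C" "k \<in> Arr C"
    using g k by (simp_all add: Hom_def)
  ultimately show ?thesis using assms(3) unfolding is_kernel_def by metis
qed

lemma is_cokernelI:
  assumes g: "g \<in> Hom C X Y" and c: "c \<in> Hom C Y Q" and "g \<cdot> c = \<zero> X Q"
    and ex: "\<And>T t. t \<in> Hom C Y T \<Longrightarrow> g \<cdot> t = \<zero> X T \<Longrightarrow> \<exists>u\<in>Hom C Q T. c \<cdot> u = t"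
    and epi: "\<And>T u. u \<in> Hom C Q T \<Longrightarrow> c \<cdot> u = \<zero> Y T \<Longrightarrow> u = \<zero> Q T"
  shows "is_cokernel C g c"
proof -
  have "u = v" if u: "u \<in> Hom C Q T" and v: "v \<in> Hom C Q T" and e: "c \<cdot> u = c \<cdot> v" for T u v
  proof -
    have uv: "u \<oplus> \<ominus> v \<in> Hom C Q T" using Add_Hom[OF u Neg_Hom[OF v]] .
    have "c \<cdot> (u \<oplus> \<ominus> v) = \<zero> Y T"
      using Comp_Add_right[OF c u Neg_Hom[OF v]] Comp_Neg_right[OF c v] e Add_Neg[OF Comp_Hom[OF c v]]
      by simp
    then have "u \<oplus> \<ominus> v = \<zero> Q T" using epi[OF uv] by simp
    then have "\<ominus> u = \<ominus> v" by (rule Neg_unique[OF u Neg_Hom[OF v]])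
    then show "u = v" using Neg_Neg[OF u] Neg_Neg[OF v] by metis
  qed
  then have "\<exists>!u. u \<in> Hom C Q T \<and> c \<cdot> u = t" if "t \<in> Hom C Y T" "g \<cdot> t = \<zero> X T" for T t
    using ex[OF that] by metis
  moreover have "Dom C g = X" "Cod C g = Y" "Dom C c = Y" "Cod C c = Q" "g \<in> Arr C" "c \<in> Arr C"
    using g c by (simp_all add: Hom_def)
  ultimately show ?thesis using assms(3) unfolding is_cokernel_def by metis
qed

text \<open>The common composite \<open>u \<cdot> k\<close> is itself a test morphism annihilated by
  \<open>g\<close>, so the uniqueness clause compares \<open>u\<close> with
  \<open>v\<close>.\<close>

lemma is_kernel_mono:
  assumes "is_kernel C g k" and u: "u \<in> Hom C T (Dom C k)" and v: "v \<in> Hom C T (Dom C k)"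
    and e: "u \<cdot> k = v \<cdot> k"
  shows "u = v"
proof -
  have k: "k \<in> Hom C (Dom C k) (Dom C g)" and g: "g \<in> Hom C (Dom C g) (Cod C g)"
    and kg: "k \<cdot> g = \<zero> (Dom C k) (Cod C g)"
    and ex1: "\<And>T t. T \<in> Obj C \<Longrightarrow> t \<in> Hom C T (Dom C g) \<Longrightarrow> t \<cdot> g = \<zero> T (Cod C g) \<Longrightarrow>
      \<exists>!u. u \<in> Hom C T (Dom C k) \<and> u \<cdot> k = t"
    using assms(1) unfolding is_kernel_def by (simp add: Hom_def, simp add: Hom_def, blast, blast)
  have "u \<cdot> k \<cdot> g = \<zero> T (Cod C g)"
    using Comp_assoc[OF u k g] kg Comp_Zero_right[OF u Hom_Obj(2)[OF g]] by simp
  from ex1[OF Hom_Obj(1)[OF u] Comp_Hom[OF u k] this] show ?thesis using u v e by metis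
qed

lemma is_cokernel_epi:
  assumes "is_cokernel C g c" and u: "u \<in> Hom C (Cod C c) T" and v: "v \<in> Hom C (Cod C c) T"
    and e: "c \<cdot> u = c \<cdot> v"
  shows "u = v"
proof -
  have c: "c \<in> Hom C (Cod C g) (Cod C c)" and g: "g \<in> Hom C (Dom C g) (Cod C g)"
    and gc: "g \<cdot> c = \<zero> (Dom C g) (Cod C c)"
    and ex1: "\<And>T t. T \<in> Obj C \<Longrightarrow> t \<in> Hom C (Cod C g) T \<Longrightarrow> g \<cdot> t = \<zero> (Dom C g) T \<Longrightarrow>
      \<exists>!u. u \<in> Hom C (Cod C c) T \<and> c \<cdot> u = t"
    using assms(1) unfolding is_cokernel_def by (simp add: Hom_def, simp add: Hom_def, blast, blast)
  have "g \<cdot> (c \<cdot> u) = \<zero> (Dom C g) T"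
    using Comp_assoc[OF g c u] gc Comp_Zero_left[OF u Hom_Obj(1)[OF g]] by simp
  from ex1[OF Hom_Obj(2)[OF u] Comp_Hom[OF c u] this] show ?thesis using u v e by metis
qed

text \<open>A kernel can be cancelled on the right and a cokernel on the left, so any solution of
  the factorisation equation is the only one.\<close>

lemma is_induced_morphismI:
  assumes p: "is_cokernel C k p" and i: "is_kernel C c i"
    and h: "h \<in> Hom C (Cod C p) (Dom C i)" "p \<cdot> h \<cdot> i = g"
  shows "is_induced_morphism C g p i h"
  unfolding is_induced_morphism_def
proof (intro conjI ballI impI h)
  fix h' assume h': "h' \<in> Hom C (Cod C p) (Dom C i)" "p \<cdot> h' \<cdot> i = g"
  have pp: "p \<in> Hom C (Dom C p) (Cod C p)"
    using p by (simp add: is_cokernel_def Hom_def)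
  have "p \<cdot> h' = p \<cdot> h"
    by (rule is_kernel_mono[OF i Comp_Hom[OF pp h'(1)] Comp_Hom[OF pp h(1)]]) (simp add: h h')
  then show "h' = h" by (rule is_cokernel_epi[OF p h'(1) h(1)])
qed

section \<open>Residue classes modulo null-homotopy\<close>

lemma quotient_D: "preadditive_quotient (diag_category C) (null_homotopic C)"
  by (intro preadditive_quotient.intro preadditive_quotient_axioms.intro preadditive_D
      ideal_null_homotopic)

text \<open>The operations of \<open>Adel\<close> work on chosen representatives; these equations
  hide the choice. They are cited by position: hom-sets, objects, identities, composition.\<close>

lemmas Adel_simps =
  preadditive_quotient.Hom_Q[OF quotient_D, folded Adel_def adel_class_def]
  preadditive_quotient.Obj_Q[OF quotient_D, folded Adel_def, unfolded D_simps]
  preadditive_quotient.Ide_Q[OF quotient_D, folded Adel_def adel_class_def]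
  preadditive_quotient.Comp_Q[OF quotient_D, folded Adel_def adel_class_def]

text \<open>Null-homotopy sees only the middle component, so only \<open>m1\<close> has to be
  compared. The equation is written additively, with \<open>m1 g\<close> next to the homotopy, to
  keep differences of matrices out of later computations.\<close>

lemma adel_class_eqI:
  assumes f: "f \<in> Hom (diag_category C) X Y" and g: "g \<in> Hom (diag_category C) X Y"
    and s: "s \<in> Hom C (ob1 C X) (ob0 C Y)" and t: "t \<in> Hom C (ob2 C X) (ob1 C Y)"
    and e: "s \<cdot> d0 Y \<oplus> d1 X \<cdot> t \<oplus> m1 g = m1 f"
  shows "adel_class C f = adel_class C g"
proof -
  interpret Q: preadditive_quotient "diag_category C" "null_homotopic C" by (rule quotient_D)
  note st = Add_Hom[OF Comp_Hom[OF s diags_Hom(1)[OF Hom_D_diags(2)[OF f]]]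
      Comp_Hom[OF diags_Hom(2)[OF Hom_D_diags(1)[OF f]] t]]
  have "s \<cdot> d0 Y \<oplus> d1 X \<cdot> t = m1 f \<oplus> \<ominus> m1 g"
    using Add_assoc[OF st Hom_D_m1[OF g] Neg_Hom[OF Hom_D_m1[OF g]]] Add_Neg[OF Hom_D_m1[OF g]]
      Add_Zero[OF st] e by simp
  then have "Add (diag_category C) f (Neg (diag_category C) g) \<in> null_homotopic C"
    by (intro null_homotopicI[OF Q.Add_Hom[OF f Q.Neg_Hom[OF g]] s t]) (simp add: D_simps)
  then show ?thesis using Q.cl_eq_iff[OF f g] by (simp add: adel_class_def)
qed

lemma adel_class_eq_Zero_iff:
  assumes f: "f \<in> Hom (diag_category C) X Y"
  shows "adel_class C f = Zero (Adel C) X Y \<longleftrightarrow>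
    (\<exists>s\<in>Hom C (ob1 C X) (ob0 C Y). \<exists>t\<in>Hom C (ob2 C X) (ob1 C Y). s \<cdot> d0 Y \<oplus> d1 X \<cdot> t = m1 f)"
proof -
  interpret Q: preadditive_quotient "diag_category C" "null_homotopic C" by (rule quotient_D)
  note o = Q.Hom_Obj[OF f]
  have "adel_class C f = Zero (Adel C) X Y \<longleftrightarrow> f \<in> null_homotopic C"
    using Q.cl_eq_iff[OF f Q.Zero_Hom[OF o]] Q.Neg_Zero[OF o] Q.Add_Zero[OF f]
    by (simp add: adel_class_def Adel_def Q.Zero_Q)
  also have "\<dots> \<longleftrightarrow> (\<exists>s\<in>Hom C (ob1 C X) (ob0 C Y). \<exists>t\<in>Hom C (ob2 C X) (ob1 C Y).
      s \<cdot> d0 Y \<oplus> d1 X \<cdot> t = m1 f)"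
    using f by (simp add: null_homotopic_def Hom_def[of "diag_category C"] D_simps)
  finally show ?thesis .
qed

text \<open>Representatives are chosen here once and for all, and what remains concerns diagrams
  only. \<open>null\<close> witnesses that the composite vanishes, \<open>ex\<close> asks for a lift
  that commutes strictly, and \<open>mono\<close> turns a null-homotopy of the composite with
  \<open>k\<close> into one of \<open>u\<close>.\<close>

lemma is_kernel_AdelI:
  assumes g: "g \<in> Hom (diag_category C) X Y" and k: "k \<in> Hom (diag_category C) K X"
    and null: "s \<in> Hom C (ob1 C K) (ob0 C Y)" "t \<in> Hom C (ob2 C K) (ob1 C Y)"
      "s \<cdot> d0 Y \<oplus> d1 K \<cdot> t = m1 k \<cdot> m1 g"
    and ex: "\<And>T t s w. t \<in> Hom (diag_category C) T X \<Longrightarrow> s \<in> Hom C (ob1 C T) (ob0 C Y) \<Longrightarrow>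
      w \<in> Hom C (ob2 C T) (ob1 C Y) \<Longrightarrow> s \<cdot> d0 Y \<oplus> d1 T \<cdot> w = m1 t \<cdot> m1 g \<Longrightarrow>
      \<exists>u\<in>Hom (diag_category C) T K. Comp (diag_category C) u k = t"
    and mono: "\<And>T u s w. u \<in> Hom (diag_category C) T K \<Longrightarrow> s \<in> Hom C (ob1 C T) (ob0 C X) \<Longrightarrow>
      w \<in> Hom C (ob2 C T) (ob1 C X) \<Longrightarrow> s \<cdot> d0 X \<oplus> d1 T \<cdot> w = m1 u \<cdot> m1 k \<Longrightarrow>
      \<exists>s'\<in>Hom C (ob1 C T) (ob0 C K). \<exists>t'\<in>Hom C (ob2 C T) (ob1 C K). s' \<cdot> d0 K \<oplus> d1 T \<cdot> t' = m1 u"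
  shows "is_kernel (Adel C) (adel_class C g) (adel_class C k)"
proof -
  interpret D: preadditive_category "diag_category C" by (rule preadditive_D)
  interpret Q: preadditive_category "Adel C" by (rule preadditive_Adel)
  show ?thesis
  proof (rule Q.is_kernelI)
    show "adel_class C g \<in> Hom (Adel C) X Y" "adel_class C k \<in> Hom (Adel C) K X"
      using g k by (simp_all add: Adel_simps)
    show "Comp (Adel C) (adel_class C k) (adel_class C g) = Zero (Adel C) K Y"
      unfolding Adel_simps(4)[OF k g] adel_class_eq_Zero_iff[OF D.Comp_Hom[OF k g]]
      using null by (auto simp: D_simps)
  next
    fix T F assume "F \<in> Hom (Adel C) T X" and z: "Comp (Adel C) F (adel_class C g) = Zero (Adel C) T Y"
    then obtain t where F: "F = adel_class C t" and t: "t \<in> Hom (diag_category C) T X"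
      by (auto simp: Adel_simps)
    from z obtain s w where "s \<in> Hom C (ob1 C T) (ob0 C Y)" "w \<in> Hom C (ob2 C T) (ob1 C Y)"
      "s \<cdot> d0 Y \<oplus> d1 T \<cdot> w = m1 t \<cdot> m1 g"
      unfolding F Adel_simps(4)[OF t g] adel_class_eq_Zero_iff[OF D.Comp_Hom[OF t g]]
      by (auto simp: D_simps)
    from ex[OF t this] obtain u where "u \<in> Hom (diag_category C) T K" "Comp (diag_category C) u k = t" by blast
    then show "\<exists>u\<in>Hom (Adel C) T K. Comp (Adel C) u (adel_class C k) = F"
      using Adel_simps(4)[OF _ k] by (auto simp: F Adel_simps(1))
  next
    fix T F assume "F \<in> Hom (Adel C) T K" and z: "Comp (Adel C) F (adel_class C k) = Zero (Adel C) T X"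
    then obtain u where F: "F = adel_class C u" and u: "u \<in> Hom (diag_category C) T K"
      by (auto simp: Adel_simps)
    from z obtain s w where "s \<in> Hom C (ob1 C T) (ob0 C X)" "w \<in> Hom C (ob2 C T) (ob1 C X)"
      "s \<cdot> d0 X \<oplus> d1 T \<cdot> w = m1 u \<cdot> m1 k"
      unfolding F Adel_simps(4)[OF u k] adel_class_eq_Zero_iff[OF D.Comp_Hom[OF u k]]
      by (auto simp: D_simps)
    from mono[OF u this] show "F = Zero (Adel C) T K"
      unfolding F adel_class_eq_Zero_iff[OF u] .
  qed
qed

lemma is_cokernel_AdelI:
  assumes g: "g \<in> Hom (diag_category C) X Y" and c: "c \<in> Hom (diag_category C) Y Q"
    and null: "s \<in> Hom C (ob1 C X) (ob0 C Q)" "t \<in> Hom C (ob2 C X) (ob1 C Q)"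
      "s \<cdot> d0 Q \<oplus> d1 X \<cdot> t = m1 g \<cdot> m1 c"
    and ex: "\<And>T t s w. t \<in> Hom (diag_category C) Y T \<Longrightarrow> s \<in> Hom C (ob1 C X) (ob0 C T) \<Longrightarrow>
      w \<in> Hom C (ob2 C X) (ob1 C T) \<Longrightarrow> s \<cdot> d0 T \<oplus> d1 X \<cdot> w = m1 g \<cdot> m1 t \<Longrightarrow>
      \<exists>u\<in>Hom (diag_category C) Q T. Comp (diag_category C) c u = t"
    and epi: "\<And>T u s w. u \<in> Hom (diag_category C) Q T \<Longrightarrow> s \<in> Hom C (ob1 C Y) (ob0 C T) \<Longrightarrow>
      w \<in> Hom C (ob2 C Y) (ob1 C T) \<Longrightarrow> s \<cdot> d0 T \<oplus> d1 Y \<cdot> w = m1 c \<cdot> m1 u \<Longrightarrow>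
      \<exists>s'\<in>Hom C (ob1 C Q) (ob0 C T). \<exists>t'\<in>Hom C (ob2 C Q) (ob1 C T). s' \<cdot> d0 T \<oplus> d1 Q \<cdot> t' = m1 u"
  shows "is_cokernel (Adel C) (adel_class C g) (adel_class C c)"
proof -
  interpret D: preadditive_category "diag_category C" by (rule preadditive_D)
  interpret Q: preadditive_category "Adel C" by (rule preadditive_Adel)
  show ?thesis
  proof (rule Q.is_cokernelI)
    show "adel_class C g \<in> Hom (Adel C) X Y" "adel_class C c \<in> Hom (Adel C) Y Q"
      using g c by (simp_all add: Adel_simps)
    show "Comp (Adel C) (adel_class C g) (adel_class C c) = Zero (Adel C) X Q"
      unfolding Adel_simps(4)[OF g c] adel_class_eq_Zero_iff[OF D.Comp_Hom[OF g c]]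
      using null by (auto simp: D_simps)
  next
    fix T F assume "F \<in> Hom (Adel C) Y T" and z: "Comp (Adel C) (adel_class C g) F = Zero (Adel C) X T"
    then obtain t where F: "F = adel_class C t" and t: "t \<in> Hom (diag_category C) Y T"
      by (auto simp: Adel_simps)
    from z obtain s w where "s \<in> Hom C (ob1 C X) (ob0 C T)" "w \<in> Hom C (ob2 C X) (ob1 C T)"
      "s \<cdot> d0 T \<oplus> d1 X \<cdot> w = m1 g \<cdot> m1 t"
      unfolding F Adel_simps(4)[OF g t] adel_class_eq_Zero_iff[OF D.Comp_Hom[OF g t]]
      by (auto simp: D_simps)
    from ex[OF t this] obtain u where "u \<in> Hom (diag_category C) Q T" "Comp (diag_category C) c u = t" by blast
    then show "\<exists>u\<in>Hom (Adel C) Q T. Comp (Adel C) (adel_class C c) u = F"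
      using Adel_simps(4)[OF c] by (auto simp: F Adel_simps(1))
  next
    fix T F assume "F \<in> Hom (Adel C) Q T" and z: "Comp (Adel C) (adel_class C c) F = Zero (Adel C) Y T"
    then obtain u where F: "F = adel_class C u" and u: "u \<in> Hom (diag_category C) Q T"
      by (auto simp: Adel_simps)
    from z obtain s w where "s \<in> Hom C (ob1 C Y) (ob0 C T)" "w \<in> Hom C (ob2 C Y) (ob1 C T)"
      "s \<cdot> d0 T \<oplus> d1 Y \<cdot> w = m1 c \<cdot> m1 u"
      unfolding F Adel_simps(4)[OF c u] adel_class_eq_Zero_iff[OF D.Comp_Hom[OF c u]]
      by (auto simp: D_simps)
    from epi[OF u this] show "F = Zero (Adel C) Q T"
      unfolding F adel_class_eq_Zero_iff[OF u] .
  qed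
qed

section \<open>A rewriting calculus for arrows\<close>

text \<open>In the axioms the objects occur in premises about \<open>Hom\<close> and often not in
  the equation itself, which makes them poor conditional rewrite rules. With \<open>Dom\<close> and
  \<open>Cod\<close> as functions the simplifier computes the objects and discharges the side
  conditions.\<close>

lemma Hom_iff: "f \<in> Hom C A B \<longleftrightarrow> f \<in> Arr C \<and> Dom C f = A \<and> Cod C f = B"
  by (auto simp: Hom_def)

lemma arr_simps:
  "f \<in> Arr C \<Longrightarrow> Dom C f \<in> Obj C" "f \<in> Arr C \<Longrightarrow> Cod C f \<in> Obj C"
  "f \<in> Arr C \<Longrightarrow> g \<in> Arr C \<Longrightarrow> Cod C f = Dom C g \<Longrightarrow> f \<cdot> g \<in> Arr C"
  "f \<in> Arr C \<Longrightarrow> g \<in> Arr C \<Longrightarrow> Cod C f = Dom C g \<Longrightarrow> Dom C (f \<cdot> g) = Dom C f"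
  "f \<in> Arr C \<Longrightarrow> g \<in> Arr C \<Longrightarrow> Cod C f = Dom C g \<Longrightarrow> Cod C (f \<cdot> g) = Cod C g"
  "A \<in> Obj C \<Longrightarrow> \<one> A \<in> Arr C" "A \<in> Obj C \<Longrightarrow> Dom C (\<one> A) = A" "A \<in> Obj C \<Longrightarrow> Cod C (\<one> A) = A"
  "A \<in> Obj C \<Longrightarrow> B \<in> Obj C \<Longrightarrow> \<zero> A B \<in> Arr C"
  "A \<in> Obj C \<Longrightarrow> B \<in> Obj C \<Longrightarrow> Dom C (\<zero> A B) = A"
  "A \<in> Obj C \<Longrightarrow> B \<in> Obj C \<Longrightarrow> Cod C (\<zero> A B) = B"
  "f \<in> Arr C \<Longrightarrow> g \<in> Arr C \<Longrightarrow> Dom C g = Dom C f \<Longrightarrow> Cod C g = Cod C f \<Longrightarrow> f \<oplus> g \<in> Arr C"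
  "f \<in> Arr C \<Longrightarrow> g \<in> Arr C \<Longrightarrow> Dom C g = Dom C f \<Longrightarrow> Cod C g = Cod C f \<Longrightarrow> Dom C (f \<oplus> g) = Dom C f"
  "f \<in> Arr C \<Longrightarrow> g \<in> Arr C \<Longrightarrow> Dom C g = Dom C f \<Longrightarrow> Cod C g = Cod C f \<Longrightarrow> Cod C (f \<oplus> g) = Cod C f"
  "f \<in> Arr C \<Longrightarrow> \<ominus> f \<in> Arr C" "f \<in> Arr C \<Longrightarrow> Dom C (\<ominus> f) = Dom C f" "f \<in> Arr C \<Longrightarrow> Cod C (\<ominus> f) = Cod C f"
  using Dom_Obj Cod_Obj Comp_Hom Ide_Hom Zero_Hom Add_Hom Neg_Hom unfolding Hom_iff by metis+

text \<open>The normal form is a right-nested sum of possibly negated right-nested composites.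
  Objects inside \<open>\<one>\<close> and \<open>\<zero>\<close> are variables tied to
  \<open>Dom\<close> and \<open>Cod\<close> by premises, so that a rule matches whichever term
  denotes the object. The last three laws cancel opposite terms inside a longer sum.\<close>

lemma hom_simps:
  "f \<in> Arr C \<Longrightarrow> Dom C f = A \<Longrightarrow> \<one> A \<cdot> f = f"
  "f \<in> Arr C \<Longrightarrow> Cod C f = B \<Longrightarrow> f \<cdot> \<one> B = f"
  "f \<in> Arr C \<Longrightarrow> g \<in> Arr C \<Longrightarrow> h \<in> Arr C \<Longrightarrow> Cod C f = Dom C g \<Longrightarrow> Cod C g = Dom C h \<Longrightarrow>
    f \<cdot> g \<cdot> h = f \<cdot> (g \<cdot> h)"
  "f \<in> Arr C \<Longrightarrow> A \<in> Obj C \<Longrightarrow> Dom C f = B \<Longrightarrow> \<zero> A B \<cdot> f = \<zero> A (Cod C f)"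
  "f \<in> Arr C \<Longrightarrow> B \<in> Obj C \<Longrightarrow> Cod C f = A \<Longrightarrow> f \<cdot> \<zero> A B = \<zero> (Dom C f) B"
  "f \<in> Arr C \<Longrightarrow> g \<in> Arr C \<Longrightarrow> Cod C f = Dom C g \<Longrightarrow> \<ominus> f \<cdot> g = \<ominus> (f \<cdot> g)"
  "f \<in> Arr C \<Longrightarrow> g \<in> Arr C \<Longrightarrow> Cod C f = Dom C g \<Longrightarrow> f \<cdot> \<ominus> g = \<ominus> (f \<cdot> g)"
  "f \<in> Arr C \<Longrightarrow> f' \<in> Arr C \<Longrightarrow> g \<in> Arr C \<Longrightarrow> Dom C f' = Dom C f \<Longrightarrow> Cod C f = Dom C g \<Longrightarrow>
    Cod C f' = Dom C g \<Longrightarrow> (f \<oplus> f') \<cdot> g = f \<cdot> g \<oplus> f' \<cdot> g"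
  "f \<in> Arr C \<Longrightarrow> g \<in> Arr C \<Longrightarrow> g' \<in> Arr C \<Longrightarrow> Cod C g' = Cod C g \<Longrightarrow> Cod C f = Dom C g \<Longrightarrow>
    Dom C g' = Dom C g \<Longrightarrow> f \<cdot> (g \<oplus> g') = f \<cdot> g \<oplus> f \<cdot> g'"
  "f \<in> Arr C \<Longrightarrow> Dom C f = A \<Longrightarrow> Cod C f = B \<Longrightarrow> f \<oplus> \<zero> A B = f"
  "f \<in> Arr C \<Longrightarrow> Dom C f = A \<Longrightarrow> Cod C f = B \<Longrightarrow> \<zero> A B \<oplus> f = f"
  "f \<in> Arr C \<Longrightarrow> \<ominus> (\<ominus> f) = f"
  "A \<in> Obj C \<Longrightarrow> B \<in> Obj C \<Longrightarrow> \<ominus> \<zero> A B = \<zero> A B"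
  "f \<in> Arr C \<Longrightarrow> g \<in> Arr C \<Longrightarrow> Dom C g = Dom C f \<Longrightarrow> Cod C g = Cod C f \<Longrightarrow> \<ominus> (f \<oplus> g) = \<ominus> f \<oplus> \<ominus> g"
  "f \<in> Arr C \<Longrightarrow> f \<oplus> \<ominus> f = \<zero> (Dom C f) (Cod C f)"
  "f \<in> Arr C \<Longrightarrow> \<ominus> f \<oplus> f = \<zero> (Dom C f) (Cod C f)"
  "f \<in> Arr C \<Longrightarrow> g \<in> Arr C \<Longrightarrow> Dom C g = Dom C f \<Longrightarrow> Cod C g = Cod C f \<Longrightarrow> f \<oplus> (\<ominus> f \<oplus> g) = g"
  "f \<in> Arr C \<Longrightarrow> g \<in> Arr C \<Longrightarrow> Dom C g = Dom C f \<Longrightarrow> Cod C g = Cod C f \<Longrightarrow> \<ominus> f \<oplus> (f \<oplus> g) = g"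
  "f \<in> Arr C \<Longrightarrow> g \<in> Arr C \<Longrightarrow> Dom C g = Dom C f \<Longrightarrow> Cod C g = Cod C f \<Longrightarrow> f \<oplus> (g \<oplus> \<ominus> f) = g"
                    apply (metis Hom_iff Ide_left)
                   apply (metis Hom_iff Ide_right)
                  apply (metis Hom_iff Comp_assoc)
                 apply (metis Hom_iff Comp_Zero_left)
                apply (metis Hom_iff Comp_Zero_right)
               apply (metis Hom_iff Comp_Neg_left)
              apply (metis Hom_iff Comp_Neg_right)
             apply (metis Hom_iff Comp_Add_left)
            apply (metis Hom_iff Comp_Add_right)
           apply (metis Hom_iff Add_Zero)
          apply (metis Hom_iff Zero_Add)
         apply (metis Hom_iff Neg_Neg)
        apply (metis Neg_Zero)
       apply (metis Hom_iff Neg_distrib)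
      apply (metis Hom_iff Add_Neg)
     apply (metis Hom_iff Neg_Add)
    apply (metis Hom_iff Neg_Add_cancel Neg_Neg Neg_Hom)
   apply (metis Hom_iff Neg_Add_cancel)
  apply (metis Hom_iff Add_commute Neg_Add_cancel Neg_Neg Neg_Hom)
  done

lemma add_ac:
  "f \<in> Arr C \<Longrightarrow> g \<in> Arr C \<Longrightarrow> h \<in> Arr C \<Longrightarrow> Dom C g = Dom C f \<Longrightarrow> Cod C g = Cod C f \<Longrightarrow>
    Dom C h = Dom C f \<Longrightarrow> Cod C h = Cod C f \<Longrightarrow> f \<oplus> g \<oplus> h = f \<oplus> (g \<oplus> h)"
  "f \<in> Arr C \<Longrightarrow> g \<in> Arr C \<Longrightarrow> Dom C g = Dom C f \<Longrightarrow> Cod C g = Cod C f \<Longrightarrow> f \<oplus> g = g \<oplus> f"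
  "f \<in> Arr C \<Longrightarrow> g \<in> Arr C \<Longrightarrow> h \<in> Arr C \<Longrightarrow> Dom C g = Dom C f \<Longrightarrow> Cod C g = Cod C f \<Longrightarrow>
    Dom C h = Dom C f \<Longrightarrow> Cod C h = Cod C f \<Longrightarrow> f \<oplus> (g \<oplus> h) = g \<oplus> (f \<oplus> h)"
    apply (metis Hom_iff Add_assoc)
   apply (metis Hom_iff Add_commute)
  apply (metis Hom_iff Add_left_commute)
  done

lemma Add_Neg_eq_ZeroD:
  assumes f: "f \<in> Hom C A B" and g: "g \<in> Hom C A B" and "f \<oplus> \<ominus> g = \<zero> A B"
  shows "f = g"
  using Neg_unique[OF f Neg_Hom[OF g] assms(3)] Neg_Neg[OF f] Neg_Neg[OF g] by metis

lemma diags_arr: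
  assumes "T \<in> diags C"
  shows "d0 T \<in> Arr C" "Dom C (d0 T) = ob0 C T" "Cod C (d0 T) = ob1 C T"
    "d1 T \<in> Arr C" "Dom C (d1 T) = ob1 C T" "Cod C (d1 T) = ob2 C T"
    "ob0 C T \<in> Obj C" "ob1 C T \<in> Obj C" "ob2 C T \<in> Obj C"
  using diags_Hom[OF assms] diags_Obj[OF assms] by (auto simp: Hom_iff)

lemma Hom_D_arr:
  assumes "t \<in> Hom (diag_category C) X Y"
  shows "m0 t \<in> Arr C" "Dom C (m0 t) = ob0 C X" "Cod C (m0 t) = ob0 C Y"
    "m1 t \<in> Arr C" "Dom C (m1 t) = ob1 C X" "Cod C (m1 t) = ob1 C Y"
    "m2 t \<in> Arr C" "Dom C (m2 t) = ob2 C X" "Cod C (m2 t) = ob2 C Y"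
    "src t = X" "trg t = Y"
    "d0 X \<cdot> m1 t = m0 t \<cdot> d0 Y" "d1 X \<cdot> m2 t = m1 t \<cdot> d1 Y"
  using assms by (auto simp: Hom_D Hom_iff)

lemma diag_simps:
  "ob0 C (Diag x y) = Dom C x" "ob1 C (Diag x y) = Dom C y" "ob2 C (Diag x y) = Cod C y"
  "Diag x y \<in> diags C \<longleftrightarrow> x \<in> Arr C \<and> y \<in> Arr C \<and> Cod C x = Dom C y"
  by (auto simp: ob0_def ob1_def ob2_def diags_def)

end

section \<open>Literal matrices, rows and columns\<close>

context direct_sum_category
begin

lemma matrix_arr:
  assumes "set As \<subseteq> Obj C" "set Bs \<subseteq> Obj C" "hmat As Bs M"
  shows "mat As Bs M \<in> Arr C" "Dom C (mat As Bs M) = sm As" "Cod C (mat As Bs M) = sm Bs"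
  using matrix_Hom[OF assms] by (simp_all add: Hom_iff)

text \<open>The entries can be recovered with \<open>entry_matrix\<close>, and the shape is fixed by
  \<open>hmat\<close>. This splits one homotopy equation between sums into separate
  equations.\<close>

lemma matrix_eq_iff:
  assumes "set As \<subseteq> Obj C" "set Bs \<subseteq> Obj C" "hmat As Bs M" "hmat As Bs N"
  shows "mat As Bs M = mat As Bs N \<longleftrightarrow> M = N"
proof
  assume e: "mat As Bs M = mat As Bs N"
  have n: "M ! k ! l = N ! k ! l" if "k < length As" "l < length Bs" for k l
    using entry_matrix[OF assms(1-3) that] entry_matrix[OF assms(1,2,4) that] e by simp
  have len: "length M = length As" "length N = length As"
    "\<And>k. k < length As \<Longrightarrow> length (M ! k) = length Bs" "\<And>k. k < length As \<Longrightarrow> length (N ! k) = length Bs"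
    using assms(3,4) by (auto simp: hom_matrix_def list_all2_conv_all_nth)
  show "M = N"
    by (rule nth_equalityI) (auto intro!: nth_equalityI simp: len n)
qed simp

lemma matrix_single_arr: "x \<in> Arr C \<Longrightarrow> Dom C x = A \<Longrightarrow> Cod C x = B \<Longrightarrow> mat [A] [B] [[x]] = x"
  using matrix_single[of x A B] by (simp add: Hom_iff)

text \<open>Here \<open>x\<close> is an arrow not given as a matrix, for instance one leaving a test
  object. It is read as a 1 by 1 matrix inside the proof, since \<open>matrix_single\<close> used
  backwards as a rewrite rule would loop.\<close>

lemma row_Comp:
  assumes "x \<in> Arr C" "Cod C x = B" "set Cs \<subseteq> Obj C" "hmat [B] Cs [r]"
  shows "x \<cdot> mat [B] Cs [r] = mat [Dom C x] Cs [map (\<lambda>y. x \<cdot> y) r]"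
proof -
  have A: "set [Dom C x] \<subseteq> Obj C" and B: "set [B] \<subseteq> Obj C" using assms(1,2) by (auto simp: arr_simps)
  have x: "x \<in> Hom C (Dom C x) B" using assms(1,2) by (simp add: Hom_iff)
  then have M: "hmat [Dom C x] [B] [[x]]" by (simp add: hom_matrix_def)
  have l: "length r = length Cs" using assms(4) by (auto simp: hom_matrix_def dest: list_all2_lengthD)
  have h: "r ! l \<in> Hom C B (Cs ! l)" if "l < length Cs" for l
    using hom_matrix_nth[OF assms(4), of 0 l] that by simp
  have "mat [Dom C x] Cs (mat_of (length [Dom C x]) (length Cs)
     (\<lambda>k l. hom_sum C ([Dom C x] ! k) (Cs ! l) (map (\<lambda>j. [[x]] ! k ! j \<cdot> [r] ! j ! l) [0..<length [B]]))) =
     mat [Dom C x] Cs [map (\<lambda>y. x \<cdot> y) r]"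
    by (rule matrix_cong[OF A assms(3)]) (simp add: l Add_Zero[OF Comp_Hom[OF x h]])
  then show ?thesis
    using matrix_Comp[OF A B assms(3) M assms(4)] matrix_single[OF x] by simp
qed

lemma col_Comp:
  assumes "x \<in> Arr C" "Dom C x = B" "set As \<subseteq> Obj C" "hmat As [B] M"
  shows "mat As [B] M \<cdot> x = mat As [Cod C x] (map (map (\<lambda>y. y \<cdot> x)) M)"
proof -
  have A: "set [Cod C x] \<subseteq> Obj C" and B: "set [B] \<subseteq> Obj C" using assms(1,2) by (auto simp: arr_simps)
  have x: "x \<in> Hom C B (Cod C x)" using assms(1,2) by (simp add: Hom_iff)
  then have M: "hmat [B] [Cod C x] [[x]]" by (simp add: hom_matrix_def)
  have l: "length M = length As" using assms(4) by (auto simp: hom_matrix_def dest: list_all2_lengthD)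
  have l1: "length (M ! k) = 1" if "k < length As" for k
    using assms(4) that by (auto simp: hom_matrix_def list_all2_conv_all_nth)
  have h: "M ! k ! 0 \<in> Hom C (As ! k) B" if "k < length As" for k
    using hom_matrix_nth[OF assms(4) that, of 0] by simp
  have "mat As [Cod C x] (mat_of (length As) (length [Cod C x])
     (\<lambda>k l. hom_sum C (As ! k) ([Cod C x] ! l) (map (\<lambda>j. M ! k ! j \<cdot> [[x]] ! j ! l) [0..<length [B]]))) =
     mat As [Cod C x] (map (map (\<lambda>y. y \<cdot> x)) M)"
    by (rule matrix_cong[OF assms(3) A]) (simp add: l l1 Add_Zero[OF Comp_Hom[OF h x]])
  then show ?thesis
    using matrix_Comp[OF assms(3) B A assms(4) M] matrix_single[OF x] by simp
qed

text \<open>Gives names to the components of a morphism from a test object, which is possible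
  because \<open>sm [X]\<close> is \<open>X\<close> itself.\<close>

lemma row_cases:
  assumes x: "x \<in> Hom C X (sm Bs)" and Bs: "set Bs \<subseteq> Obj C"
  obtains r where "x = mat [X] Bs [r]" "list_all2 (\<lambda>B m. m \<in> Hom C X B) Bs r"
proof -
  have X: "X \<in> Obj C" using Hom_Obj[OF x] by simp
  then have "set [X] \<subseteq> Obj C" "x \<in> Hom C (sm [X]) (sm Bs)" using x by (simp_all add: dsum_single)
  from ex_matrix[OF this(1) Bs this(2)] show thesis
    using that by (auto simp: hom_matrix_def list_all2_Cons1)
qed

lemma col_cases:
  assumes x: "x \<in> Hom C (sm As) X" and As: "set As \<subseteq> Obj C"
  obtains r where "x = mat As [X] (map (\<lambda>m. [m]) r)" "list_all2 (\<lambda>A m. m \<in> Hom C A X) As r"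
proof -
  have X: "X \<in> Obj C" using Hom_Obj[OF x] by simp
  then have "set [X] \<subseteq> Obj C" "x \<in> Hom C (sm As) (sm [X])" using x by (simp_all add: dsum_single)
  from ex_matrix[OF As this] obtain M where M: "hmat As [X] M" "x = mat As [X] M" by blast
  \<comment> \<open>Every row of a matrix with one column is a singleton; the induction gathers
    these into one list of entries.\<close>
  have 1: "\<exists>r. M = map (\<lambda>m. [m]) r \<and> list_all2 (\<lambda>A m. m \<in> Hom C A X) As r"
    using M(1) unfolding hom_matrix_def
  proof (induction rule: list_all2_induct)
    case (Cons A As m M)
    then obtain r y where "M = map (\<lambda>m. [m]) r" "list_all2 (\<lambda>A m. m \<in> Hom C A X) As r" "m = [y]" "y \<in> Hom C A X"
      by (auto simp: list_all2_Cons1)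
    then show ?case by (intro exI[of _ "y # r"]) simp
  qed simp
  then show thesis using M(2) that by blast
qed

lemmas matrix_simps = matrix_arr matrix_single_arr matrix_Add matrix_Comp mat_of_def hom_matrix_def upt_Suc
  dsum_Obj dsum_single(1)

end

section \<open>The diagrams and morphisms of the factorisation\<close>

text \<open>The six objects are parameters of their own, so that sources and targets simplify to
  atomic terms.\<close>

locale diagram_morphism = direct_sum_category +
  fixes a0 a1 b0 b1 f0 f1 f2 A0 A1 A2 B0 B1 B2
  assumes a: "a0 \<in> Hom C A0 A1" "a1 \<in> Hom C A1 A2"
    and b: "b0 \<in> Hom C B0 B1" "b1 \<in> Hom C B1 B2"
    and f: "f0 \<in> Hom C A0 B0" "f1 \<in> Hom C A1 B1" "f2 \<in> Hom C A2 B2"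
    and sq: "a0 \<cdot> f1 = f0 \<cdot> b0" "a1 \<cdot> f2 = f1 \<cdot> b1"
begin

lemma objs [simp]: "A0 \<in> Obj C" "A1 \<in> Obj C" "A2 \<in> Obj C" "B0 \<in> Obj C" "B1 \<in> Obj C" "B2 \<in> Obj C"
  using a b Hom_Obj by auto

lemma arrs [simp]:
  "a0 \<in> Arr C" "Dom C a0 = A0" "Cod C a0 = A1"
  "a1 \<in> Arr C" "Dom C a1 = A1" "Cod C a1 = A2"
  "b0 \<in> Arr C" "Dom C b0 = B0" "Cod C b0 = B1"
  "b1 \<in> Arr C" "Dom C b1 = B1" "Cod C b1 = B2"
  "f0 \<in> Arr C" "Dom C f0 = A0" "Cod C f0 = B0"
  "f1 \<in> Arr C" "Dom C f1 = A1" "Cod C f1 = B1"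
  "f2 \<in> Arr C" "Dom C f2 = A2" "Cod C f2 = B2"
  using a b f by (simp_all add: Hom_def)

definition "A = Diag a0 a1"
definition "B = Diag b0 b1"
definition "F = Mor A B f0 f1 f2"

definition "K = Diag
      (mat [A0, B0] [A1, B0]
        [[a0,         \<zero> A0 B0],
         [\<zero> B0 A1,   \<one> B0]])
      (mat [A1, B0] [A2, B1]
        [[a1,         f1],
         [\<zero> B0 A2,   \<ominus> b0]])"
(* the cokernel object, called C on paper; here C is the category *)
definition "Q = Diag
      (mat [B0, A1] [B1, A2]
        [[b0,         \<zero> B0 A2],
         [f1,         \<ominus> a1]])
      (mat [B1, A2] [B2, A2]
        [[b1,         \<zero> B1 A2],
         [\<zero> A2 B2,   \<one> A2]])"
text \<open>The first column of the first arrow consists of a0 above the middle component (1, 0) of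
  \<open>k\<close>; the lower right block is the negative of the second arrow of \<open>K\<close>,
  hence the entry b0 with a positive sign.\<close>

definition "J = Diag
      (mat [A0, A1, B0] [A1, A2, B1]
        [[a0,         \<zero> A0 A2,   \<zero> A0 B1],
         [\<one> A1,      \<ominus> a1,      \<ominus> f1],
         [\<zero> B0 A1,   \<zero> B0 A2,   b0]])
      (mat [A1, A2, B1] [A2, A2, B1]
        [[a1,         \<zero> A1 A2,   \<zero> A1 B1],
         [\<zero> A2 A2,   \<one> A2,      \<zero> A2 B1],
         [\<zero> B1 A2,   \<zero> B1 A2,   \<one> B1]])"
text \<open>The first row of the second arrow is b1 followed by the middle component (1 0) of
  \<open>c\<close>; below it stands the negative of the first arrow of \<open>Q\<close>.\<close>

definition "I = Diag
      (mat [B0, B0, A1] [B1, B0, A1]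
        [[b0,         \<zero> B0 B0,   \<zero> B0 A1],
         [\<zero> B0 B1,   \<one> B0,      \<zero> B0 A1],
         [\<zero> A1 B1,   \<zero> A1 B0,   \<one> A1]])
      (mat [B1, B0, A1] [B2, B1, A2]
        [[b1,         \<one> B1,      \<zero> B1 A2],
         [\<zero> B0 B2,   \<ominus> b0,      \<zero> B0 A2],
         [\<zero> A1 B2,   \<ominus> f1,      a1]])"
definition "k = Mor K A
      (mat [A0, B0] [A0] [[\<one> A0], [\<zero> B0 A0]])
      (mat [A1, B0] [A1] [[\<one> A1], [\<zero> B0 A1]])
      (mat [A2, B1] [A2] [[\<one> A2], [\<zero> B1 A2]])"
definition "c = Mor B Q
      (mat [B0] [B0, A1] [[\<one> B0, \<zero> B0 A1]])
      (mat [B1] [B1, A2] [[\<one> B1, \<zero> B1 A2]])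
      (mat [B2] [B2, A2] [[\<one> B2, \<zero> B2 A2]])"
definition "p = Mor A J
      (mat [A0] [A0, A1, B0] [[\<one> A0, \<zero> A0 A1, \<zero> A0 B0]])
      (mat [A1] [A1, A2, B1] [[\<one> A1, \<zero> A1 A2, \<zero> A1 B1]])
      (mat [A2] [A2, A2, B1] [[\<one> A2, \<zero> A2 A2, \<zero> A2 B1]])"
definition "i = Mor I B
      (mat [B0, B0, A1] [B0] [[\<one> B0], [\<zero> B0 B0], [\<zero> A1 B0]])
      (mat [B1, B0, A1] [B1] [[\<one> B1], [\<zero> B0 B1], [\<zero> A1 B1]])
      (mat [B2, B1, A2] [B2] [[\<one> B2], [\<zero> B1 B2], [\<zero> A2 B2]])"
text \<open>The corners f0, f1, f2 make the composite with \<open>p\<close> and \<open>i\<close>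
  strictly equal to \<open>F\<close>. The middle matrix determines much of the rest:
  \<open>d1 J\<close> is the identity on its last two summands, which fixes the last two rows of the
  third matrix, and \<open>d0 I\<close> is the identity on its last two, which fixes the last two
  columns of the first.\<close>

definition "h = Mor J I
      (mat [A0, A1, B0] [B0, B0, A1]
        [[f0,         \<zero> A0 B0,   a0],
         [\<zero> A1 B0,   \<zero> A1 B0,   \<one> A1],
         [\<one> B0,      \<zero> B0 B0,   \<zero> B0 A1]])
      (mat [A1, A2, B1] [B1, B0, A1]
        [[f1,         \<zero> A1 B0,   \<one> A1],
         [\<zero> A2 B1,   \<zero> A2 B0,   \<zero> A2 A1],
         [\<one> B1,      \<zero> B1 B0,   \<zero> B1 A1]])
      (mat [A2, A2, B1] [B2, B1, A2]
        [[f2,         \<zero> A2 B1,   \<one> A2],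
         [\<zero> A2 B2,   \<zero> A2 B1,   \<zero> A2 A2],
         [b1,         \<one> B1,      \<zero> B1 A2]])"
text \<open>As \<open>d0 I\<close> is the identity on its last two summands, the last two rows of
  the middle matrix are those of the first matrix times \<open>d0 J\<close>; in particular its A1
  row is the second row of \<open>d0 J\<close>.\<close>

definition "h_inv = Mor I J
      (mat [B0, B0, A1] [A0, A1, B0]
        [[\<zero> B0 A0,   \<zero> B0 A1,   \<one> B0],
         [\<zero> B0 A0,   \<zero> B0 A1,   \<ominus> \<one> B0],
         [\<zero> A1 A0,   \<one> A1,      \<zero> A1 B0]])
      (mat [B1, B0, A1] [A1, A2, B1]
        [[\<zero> B1 A1,   \<zero> B1 A2,   \<one> B1],
         [\<zero> B0 A1,   \<zero> B0 A2,   \<ominus> b0],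
         [\<one> A1,      \<ominus> a1,      \<ominus> f1]])
      (mat [B2, B1, A2] [A2, A2, B1]
        [[\<zero> B2 A2,   \<zero> B2 A2,   \<zero> B2 B1],
         [\<zero> B1 A2,   \<zero> B1 A2,   \<one> B1],
         [\<one> A2,      \<ominus> \<one> A2,   \<zero> A2 B1]])"

text \<open>One rule set for typing, matrix products and normal forms. \<open>row_Comp\<close> and
  \<open>col_Comp\<close> are added only where a single row or column meets an arrow that is not
  given as a matrix.\<close>

lemmas arrow_calc = Hom_iff arr_simps hom_simps add_ac matrix_simps diag_simps sq D_simps

lemma diags: "A \<in> diags C" "B \<in> diags C" "K \<in> diags C" "Q \<in> diags C" "J \<in> diags C" "I \<in> diags C"
  by (simp_all add: A_def B_def K_def Q_def J_def I_def arrow_calc)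

lemma ob_simps [simp]:
  "ob0 C A = A0" "ob1 C A = A1" "ob2 C A = A2" "ob0 C B = B0" "ob1 C B = B1" "ob2 C B = B2"
  "ob0 C K = sm [A0, B0]" "ob1 C K = sm [A1, B0]" "ob2 C K = sm [A2, B1]"
  "ob0 C Q = sm [B0, A1]" "ob1 C Q = sm [B1, A2]" "ob2 C Q = sm [B2, A2]"
  "ob0 C J = sm [A0, A1, B0]" "ob1 C J = sm [A1, A2, B1]" "ob2 C J = sm [A2, A2, B1]"
  "ob0 C I = sm [B0, B0, A1]" "ob1 C I = sm [B1, B0, A1]" "ob2 C I = sm [B2, B1, A2]"
  by (simp_all add: A_def B_def K_def Q_def J_def I_def arrow_calc)

lemma F_Hom: "F \<in> Hom (diag_category C) A B"
  unfolding F_def by (rule Hom_DI[OF diags(1,2)]) (simp_all add: A_def B_def arrow_calc)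


lemmas diagram_calc = arrow_calc A_def B_def K_def Q_def J_def I_def

lemma k_Hom: "k \<in> Hom (diag_category C) K A"
  unfolding k_def by (rule Hom_DI[OF diags(3,1)]) (simp_all add: diagram_calc col_Comp)

lemma c_Hom: "c \<in> Hom (diag_category C) B Q"
  unfolding c_def by (rule Hom_DI[OF diags(2,4)]) (simp_all add: diagram_calc row_Comp)

lemma p_Hom: "p \<in> Hom (diag_category C) A J"
  unfolding p_def by (rule Hom_DI[OF diags(1,5)]) (simp_all add: diagram_calc row_Comp)

lemma i_Hom: "i \<in> Hom (diag_category C) I B"
  unfolding i_def by (rule Hom_DI[OF diags(6,2)]) (simp_all add: diagram_calc col_Comp)

lemma h_Hom: "h \<in> Hom (diag_category C) J I"
  unfolding h_def by (rule Hom_DI[OF diags(5,6)]) (simp_all add: diagram_calc)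

lemma h_inv_Hom: "h_inv \<in> Hom (diag_category C) I J"
  unfolding h_inv_def by (rule Hom_DI[OF diags(6,5)]) (simp_all add: diagram_calc)

section \<open>The four universal properties\<close>

lemma is_kernel_k: "is_kernel (Adel C) (adel_class C F) (adel_class C k)"
proof (rule is_kernel_AdelI[OF F_Hom k_Hom, where
      s = "mat [A1, B0] [B0] [[\<zero> A1 B0], [\<one> B0]]" and t = "mat [A2, B1] [B1] [[\<zero> A2 B1], [\<one> B1]]"])
  \<comment> \<open>Both parts of the null-homotopy are projections to the second summand:
    \<open>d1 K\<close> yields the column (f1, -b0), and the b0 coming from \<open>s\<close> cancels
    its lower entry.\<close>
  show "mat [A1, B0] [B0] [[\<zero> A1 B0], [\<one> B0]] \<in> Hom C (ob1 C K) (ob0 C B)"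
    "mat [A2, B1] [B1] [[\<zero> A2 B1], [\<one> B1]] \<in> Hom C (ob2 C K) (ob1 C B)"
    "mat [A1, B0] [B0] [[\<zero> A1 B0], [\<one> B0]] \<cdot> d0 B \<oplus>
      d1 K \<cdot> mat [A2, B1] [B1] [[\<zero> A2 B1], [\<one> B1]] = m1 k \<cdot> m1 F"
    by (simp_all add: F_def k_def diagram_calc col_Comp)
next
  fix T t s w
  assume t: "t \<in> Hom (diag_category C) T A"
    and s: "s \<in> Hom C (ob1 C T) (ob0 C B)" and w: "w \<in> Hom C (ob2 C T) (ob1 C B)"
    and e: "s \<cdot> d0 B \<oplus> d1 T \<cdot> w = m1 t \<cdot> m1 F"
  note [simp] = Hom_D_arr[OF t] diags_arr[OF Hom_D_diags(1)[OF t]]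
    s[unfolded Hom_iff] w[unfolded Hom_iff]
  \<comment> \<open>The entry \<open>d0 T \<cdot> s\<close> is dictated by the first square, because
    \<open>d0 K\<close> is the identity on B0. The second square is the homotopy equation, solved
    for \<open>m1 t \<cdot> f1\<close> in \<open>e'\<close>.\<close>
  define u where "u = Mor T K (mat [ob0 C T] [A0, B0] [[m0 t, d0 T \<cdot> s]])
    (mat [ob1 C T] [A1, B0] [[m1 t, s]]) (mat [ob2 C T] [A2, B1] [[m2 t, w]])"
  have e': "m1 t \<cdot> f1 = s \<cdot> b0 \<oplus> d1 T \<cdot> w" using e by (simp add: F_def B_def)
  have "u \<in> Hom (diag_category C) T K"
    unfolding u_def by (rule Hom_DI[OF Hom_D_diags(1)[OF t] diags(3)])
      (simp_all add: diagram_calc row_Comp e')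
  moreover have "Comp (diag_category C) u k = t"
    by (rule diag_mor.expand) (simp add: u_def k_def diagram_calc)
  ultimately show "\<exists>u\<in>Hom (diag_category C) T K. Comp (diag_category C) u k = t" by blast
next
  fix T u s w
  assume u: "u \<in> Hom (diag_category C) T K"
    and s: "s \<in> Hom C (ob1 C T) (ob0 C A)" and w: "w \<in> Hom C (ob2 C T) (ob1 C A)"
    and e: "s \<cdot> d0 A \<oplus> d1 T \<cdot> w = m1 u \<cdot> m1 k"
  note [simp] = diags_arr[OF Hom_D_diags(1)[OF u]] s[unfolded Hom_iff] w[unfolded Hom_iff]
  obtain x y where u1: "m1 u = mat [ob1 C T] [A1, B0] [[x, y]]"
    and [simp]: "x \<in> Arr C" "Dom C x = ob1 C T" "Cod C x = A1" "y \<in> Arr C" "Dom C y = ob1 C T" "Cod C y = B0"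
    by (rule row_cases[of "m1 u" "ob1 C T" "[A1, B0]"])
      (use Hom_D_m1[OF u] in \<open>auto simp: list_all2_Cons1 Hom_iff\<close>)
  have x: "x = s \<cdot> a0 \<oplus> d1 T \<cdot> w" using e by (simp add: u1 k_def diagram_calc)
  \<comment> \<open>The given homotopy takes care of \<open>x\<close>. The free entry
    \<open>y\<close> is put into \<open>s'\<close>, where the identity on B0 in \<open>d0 K\<close>
    reproduces it.\<close>
  show "\<exists>s'\<in>Hom C (ob1 C T) (ob0 C K). \<exists>t'\<in>Hom C (ob2 C T) (ob1 C K). s' \<cdot> d0 K \<oplus> d1 T \<cdot> t' = m1 u"
    by (rule bexI[of _ "mat [ob1 C T] [A0, B0] [[s, y]]"],
        rule bexI[of _ "mat [ob2 C T] [A1, B0] [[w, \<zero> (ob2 C T) B0]]"])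
      (simp_all add: u1 x diagram_calc row_Comp)
qed

lemma is_cokernel_c: "is_cokernel (Adel C) (adel_class C F) (adel_class C c)"
proof (rule is_cokernel_AdelI[OF F_Hom c_Hom, where
      s = "mat [A1] [B0, A1] [[\<zero> A1 B0, \<one> A1]]" and t = "mat [A2] [B1, A2] [[\<zero> A2 B1, \<one> A2]]"])
  show "mat [A1] [B0, A1] [[\<zero> A1 B0, \<one> A1]] \<in> Hom C (ob1 C A) (ob0 C Q)"
    "mat [A2] [B1, A2] [[\<zero> A2 B1, \<one> A2]] \<in> Hom C (ob2 C A) (ob1 C Q)"
    "mat [A1] [B0, A1] [[\<zero> A1 B0, \<one> A1]] \<cdot> d0 Q \<oplus>
      d1 A \<cdot> mat [A2] [B1, A2] [[\<zero> A2 B1, \<one> A2]] = m1 F \<cdot> m1 c"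
    by (simp_all add: F_def c_def diagram_calc row_Comp)
next
  fix T t s w
  assume t: "t \<in> Hom (diag_category C) B T"
    and s: "s \<in> Hom C (ob1 C A) (ob0 C T)" and w: "w \<in> Hom C (ob2 C A) (ob1 C T)"
    and e: "s \<cdot> d0 T \<oplus> d1 A \<cdot> w = m1 F \<cdot> m1 t"
  note [simp] = Hom_D_arr[OF t] diags_arr[OF Hom_D_diags(2)[OF t]]
    s[unfolded Hom_iff] w[unfolded Hom_iff]
  define u where "u = Mor Q T (mat [B0, A1] [ob0 C T] [[m0 t], [s]])
    (mat [B1, A2] [ob1 C T] [[m1 t], [w]]) (mat [B2, A2] [ob2 C T] [[m2 t], [w \<cdot> d1 T]])"
  have e': "f1 \<cdot> m1 t = s \<cdot> d0 T \<oplus> a1 \<cdot> w" using e by (simp add: F_def A_def)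
  \<comment> \<open>The squares of \<open>t\<close> are known in terms of \<open>d0 B\<close> and
    \<open>d1 B\<close>, which unfolding \<open>B\<close> removes from the goal; they are restated
    with the entries.\<close>
  have "b0 \<cdot> m1 t = m0 t \<cdot> d0 T" "b1 \<cdot> m2 t = m1 t \<cdot> d1 T"
    using Hom_D_sq0[OF t] Hom_D_sq1[OF t] by (simp_all add: B_def)
  then have "u \<in> Hom (diag_category C) Q T"
    unfolding u_def by (intro Hom_DI[OF diags(4) Hom_D_diags(2)[OF t]])
      (simp_all add: diagram_calc col_Comp e')
  moreover have "Comp (diag_category C) c u = t"
    by (rule diag_mor.expand) (simp add: u_def c_def diagram_calc)
  ultimately show "\<exists>u\<in>Hom (diag_category C) Q T. Comp (diag_category C) c u = t" by blast
next
  fix T u s w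
  assume u: "u \<in> Hom (diag_category C) Q T"
    and s: "s \<in> Hom C (ob1 C B) (ob0 C T)" and w: "w \<in> Hom C (ob2 C B) (ob1 C T)"
    and e: "s \<cdot> d0 T \<oplus> d1 B \<cdot> w = m1 c \<cdot> m1 u"
  note [simp] = diags_arr[OF Hom_D_diags(2)[OF u]] s[unfolded Hom_iff] w[unfolded Hom_iff]
  obtain x y where u1: "m1 u = mat [B1, A2] [ob1 C T] [[x], [y]]"
    and [simp]: "x \<in> Arr C" "Dom C x = B1" "Cod C x = ob1 C T" "y \<in> Arr C" "Dom C y = A2" "Cod C y = ob1 C T"
    by (rule col_cases[of "m1 u" "[B1, A2]" "ob1 C T"])
      (use Hom_D_m1[OF u] in \<open>auto simp: list_all2_Cons1 Hom_iff\<close>)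
  have x: "x = s \<cdot> d0 T \<oplus> b1 \<cdot> w" using e by (simp add: u1 c_def diagram_calc)
  \<comment> \<open>Dually to the kernel, \<open>y\<close> goes into \<open>t'\<close>, since now
    \<open>d1 Q\<close> is the identity on A2.\<close>
  show "\<exists>s'\<in>Hom C (ob1 C Q) (ob0 C T). \<exists>t'\<in>Hom C (ob2 C Q) (ob1 C T). s' \<cdot> d0 T \<oplus> d1 Q \<cdot> t' = m1 u"
    by (rule bexI[of _ "mat [B1, A2] [ob0 C T] [[s], [\<zero> A2 (ob0 C T)]]"],
        rule bexI[of _ "mat [B2, A2] [ob1 C T] [[w], [y]]"])
      (simp_all add: u1 x diagram_calc col_Comp)
qed

lemma is_cokernel_p: "is_cokernel (Adel C) (adel_class C k) (adel_class C p)"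
proof (rule is_cokernel_AdelI[OF k_Hom p_Hom, where
      s = "mat [A1, B0] [A0, A1, B0] [[\<zero> A1 A0, \<one> A1, \<zero> A1 B0], [\<zero> B0 A0, \<zero> B0 A1, \<one> B0]]" and
      t = "mat [A2, B1] [A1, A2, B1] [[\<zero> A2 A1, \<one> A2, \<zero> A2 B1], [\<zero> B1 A1, \<zero> B1 A2, \<one> B1]]"])
  \<comment> \<open>\<open>s\<close> and \<open>t\<close> include the two summands as the last two
    of \<open>J\<close>. Then \<open>s \<cdot> d0 J\<close> consists of the last two rows of
    \<open>d0 J\<close>, and \<open>d1 K \<cdot> t\<close> cancels everything in them except the 1
    in the corner.\<close>
  show "mat [A1, B0] [A0, A1, B0] [[\<zero> A1 A0, \<one> A1, \<zero> A1 B0], [\<zero> B0 A0, \<zero> B0 A1, \<one> B0]]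
      \<in> Hom C (ob1 C K) (ob0 C J)"
    "mat [A2, B1] [A1, A2, B1] [[\<zero> A2 A1, \<one> A2, \<zero> A2 B1], [\<zero> B1 A1, \<zero> B1 A2, \<one> B1]]
      \<in> Hom C (ob2 C K) (ob1 C J)"
    "mat [A1, B0] [A0, A1, B0] [[\<zero> A1 A0, \<one> A1, \<zero> A1 B0], [\<zero> B0 A0, \<zero> B0 A1, \<one> B0]] \<cdot> d0 J \<oplus>
      d1 K \<cdot> mat [A2, B1] [A1, A2, B1] [[\<zero> A2 A1, \<one> A2, \<zero> A2 B1], [\<zero> B1 A1, \<zero> B1 A2, \<one> B1]] =
      m1 k \<cdot> m1 p"
    by (simp_all add: k_def p_def diagram_calc)
next
  fix T t s w
  assume t: "t \<in> Hom (diag_category C) A T"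
    and s: "s \<in> Hom C (ob1 C K) (ob0 C T)" and w: "w \<in> Hom C (ob2 C K) (ob1 C T)"
    and e: "s \<cdot> d0 T \<oplus> d1 K \<cdot> w = m1 k \<cdot> m1 t"
  note [simp] = Hom_D_arr[OF t] diags_arr[OF Hom_D_diags(2)[OF t]]
  obtain s1 s2 where s_eq: "s = mat [A1, B0] [ob0 C T] [[s1], [s2]]"
    and [simp]: "s1 \<in> Arr C" "Dom C s1 = A1" "Cod C s1 = ob0 C T" "s2 \<in> Arr C" "Dom C s2 = B0" "Cod C s2 = ob0 C T"
    by (rule col_cases[of s "[A1, B0]" "ob0 C T"])
      (use s in \<open>auto simp: list_all2_Cons1 Hom_iff\<close>)
  obtain w1 w2 where w_eq: "w = mat [A2, B1] [ob1 C T] [[w1], [w2]]"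
    and [simp]: "w1 \<in> Arr C" "Dom C w1 = A2" "Cod C w1 = ob1 C T" "w2 \<in> Arr C" "Dom C w2 = B1" "Cod C w2 = ob1 C T"
    by (rule col_cases[of w "[A2, B1]" "ob1 C T"])
      (use w in \<open>auto simp: list_all2_Cons1 Hom_iff\<close>)
  define u where "u = Mor J T (mat [A0, A1, B0] [ob0 C T] [[m0 t], [s1], [s2]])
    (mat [A1, A2, B1] [ob1 C T] [[m1 t], [w1], [w2]])
    (mat [A2, A2, B1] [ob2 C T] [[m2 t], [w1 \<cdot> d1 T], [w2 \<cdot> d1 T]])"
  \<comment> \<open>The homotopy starts at a sum, so its equation has two rows. They are the
    conditions for the A1 row and the B0 row in the first square of \<open>u\<close>; the A0 row is
    the first square of \<open>t\<close>.\<close>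
  have "mat [A1, B0] [ob1 C T] [[s1 \<cdot> d0 T \<oplus> (a1 \<cdot> w1 \<oplus> f1 \<cdot> w2)], [s2 \<cdot> d0 T \<oplus> \<ominus> (b0 \<cdot> w2)]] =
      mat [A1, B0] [ob1 C T] [[m1 t], [\<zero> B0 (ob1 C T)]]"
    using e by (simp add: s_eq w_eq k_def diagram_calc col_Comp)
  then have "s1 \<cdot> d0 T \<oplus> (a1 \<cdot> w1 \<oplus> f1 \<cdot> w2) = m1 t \<and> s2 \<cdot> d0 T \<oplus> \<ominus> (b0 \<cdot> w2) = \<zero> B0 (ob1 C T)"
    by (subst (asm) matrix_eq_iff) (simp_all add: diagram_calc)
  then have e1: "s1 \<cdot> d0 T \<oplus> (a1 \<cdot> w1 \<oplus> f1 \<cdot> w2) = m1 t" and z: "s2 \<cdot> d0 T \<oplus> \<ominus> (b0 \<cdot> w2) = \<zero> B0 (ob1 C T)"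
    by simp_all
  have e2: "s2 \<cdot> d0 T = b0 \<cdot> w2"
    by (rule Add_Neg_eq_ZeroD[OF _ _ z]) (simp_all add: diagram_calc)
  \<comment> \<open>The first row is rearranged into the shape in which the square appears after
    normalisation.\<close>
  have e1': "m1 t \<oplus> (\<ominus> (a1 \<cdot> w1) \<oplus> \<ominus> (f1 \<cdot> w2)) = s1 \<cdot> d0 T"
    unfolding e1[symmetric] by (simp add: diagram_calc)
  have "a0 \<cdot> m1 t = m0 t \<cdot> d0 T" "a1 \<cdot> m2 t = m1 t \<cdot> d1 T"
    using Hom_D_sq0[OF t] Hom_D_sq1[OF t] by (simp_all add: A_def)
  then have "u \<in> Hom (diag_category C) J T"
    using e1' unfolding u_def by (intro Hom_DI[OF diags(5) Hom_D_diags(2)[OF t]])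
      (simp_all add: diagram_calc col_Comp e2)
  moreover have "Comp (diag_category C) p u = t"
    by (rule diag_mor.expand) (simp add: u_def p_def diagram_calc)
  ultimately show "\<exists>u\<in>Hom (diag_category C) J T. Comp (diag_category C) p u = t" by blast
next
  fix T u s w
  assume u: "u \<in> Hom (diag_category C) J T"
    and s: "s \<in> Hom C (ob1 C A) (ob0 C T)" and w: "w \<in> Hom C (ob2 C A) (ob1 C T)"
    and e: "s \<cdot> d0 T \<oplus> d1 A \<cdot> w = m1 p \<cdot> m1 u"
  note [simp] = diags_arr[OF Hom_D_diags(2)[OF u]] s[unfolded Hom_iff] w[unfolded Hom_iff]
  obtain x y z where u1: "m1 u = mat [A1, A2, B1] [ob1 C T] [[x], [y], [z]]"
    and [simp]: "x \<in> Arr C" "Dom C x = A1" "Cod C x = ob1 C T" "y \<in> Arr C" "Dom C y = A2" "Cod C y = ob1 C T"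
      "z \<in> Arr C" "Dom C z = B1" "Cod C z = ob1 C T"
    by (rule col_cases[of "m1 u" "[A1, A2, B1]" "ob1 C T"])
      (use Hom_D_m1[OF u] in \<open>auto simp: list_all2_Cons1 Hom_iff\<close>)
  have x: "x = s \<cdot> d0 T \<oplus> a1 \<cdot> w" using e by (simp add: u1 p_def diagram_calc)
  \<comment> \<open>The identities on A2 and B1 in \<open>d1 J\<close> absorb both free entries
    \<open>y\<close> and \<open>z\<close>.\<close>
  show "\<exists>s'\<in>Hom C (ob1 C J) (ob0 C T). \<exists>t'\<in>Hom C (ob2 C J) (ob1 C T). s' \<cdot> d0 T \<oplus> d1 J \<cdot> t' = m1 u"
    by (rule bexI[of _ "mat [A1, A2, B1] [ob0 C T] [[s], [\<zero> A2 (ob0 C T)], [\<zero> B1 (ob0 C T)]]"],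
        rule bexI[of _ "mat [A2, A2, B1] [ob1 C T] [[w], [y], [z]]"])
      (simp_all add: u1 x diagram_calc col_Comp)
qed

lemma is_kernel_i: "is_kernel (Adel C) (adel_class C c) (adel_class C i)"
proof (rule is_kernel_AdelI[OF c_Hom i_Hom, where
      s = "mat [B1, B0, A1] [B0, A1] [[\<zero> B1 B0, \<zero> B1 A1], [\<one> B0, \<zero> B0 A1], [\<zero> A1 B0, \<one> A1]]" and
      t = "mat [B2, B1, A2] [B1, A2] [[\<zero> B2 B1, \<zero> B2 A2], [\<one> B1, \<zero> B1 A2], [\<zero> A2 B1, \<one> A2]]"])
  show "mat [B1, B0, A1] [B0, A1] [[\<zero> B1 B0, \<zero> B1 A1], [\<one> B0, \<zero> B0 A1], [\<zero> A1 B0, \<one> A1]]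
      \<in> Hom C (ob1 C I) (ob0 C Q)"
    "mat [B2, B1, A2] [B1, A2] [[\<zero> B2 B1, \<zero> B2 A2], [\<one> B1, \<zero> B1 A2], [\<zero> A2 B1, \<one> A2]]
      \<in> Hom C (ob2 C I) (ob1 C Q)"
    "mat [B1, B0, A1] [B0, A1] [[\<zero> B1 B0, \<zero> B1 A1], [\<one> B0, \<zero> B0 A1], [\<zero> A1 B0, \<one> A1]] \<cdot> d0 Q \<oplus>
      d1 I \<cdot> mat [B2, B1, A2] [B1, A2] [[\<zero> B2 B1, \<zero> B2 A2], [\<one> B1, \<zero> B1 A2], [\<zero> A2 B1, \<one> A2]] =
      m1 i \<cdot> m1 c"
    by (simp_all add: i_def c_def diagram_calc)
next
  fix T t s w
  assume t: "t \<in> Hom (diag_category C) T B"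
    and s: "s \<in> Hom C (ob1 C T) (ob0 C Q)" and w: "w \<in> Hom C (ob2 C T) (ob1 C Q)"
    and e: "s \<cdot> d0 Q \<oplus> d1 T \<cdot> w = m1 t \<cdot> m1 c"
  note [simp] = Hom_D_arr[OF t] diags_arr[OF Hom_D_diags(1)[OF t]]
  obtain s1 s2 where s_eq: "s = mat [ob1 C T] [B0, A1] [[s1, s2]]"
    and [simp]: "s1 \<in> Arr C" "Dom C s1 = ob1 C T" "Cod C s1 = B0" "s2 \<in> Arr C" "Dom C s2 = ob1 C T" "Cod C s2 = A1"
    by (rule row_cases[of s "ob1 C T" "[B0, A1]"])
      (use s in \<open>auto simp: list_all2_Cons1 Hom_iff\<close>)
  obtain w1 w2 where w_eq: "w = mat [ob2 C T] [B1, A2] [[w1, w2]]"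
    and [simp]: "w1 \<in> Arr C" "Dom C w1 = ob2 C T" "Cod C w1 = B1" "w2 \<in> Arr C" "Dom C w2 = ob2 C T" "Cod C w2 = A2"
    by (rule row_cases[of w "ob2 C T" "[B1, A2]"])
      (use w in \<open>auto simp: list_all2_Cons1 Hom_iff\<close>)
  define u where "u = Mor T I (mat [ob0 C T] [B0, B0, A1] [[m0 t, d0 T \<cdot> s1, d0 T \<cdot> s2]])
    (mat [ob1 C T] [B1, B0, A1] [[m1 t, s1, s2]]) (mat [ob2 C T] [B2, B1, A2] [[m2 t, w1, w2]])"
  \<comment> \<open>The homotopy ends in a sum, so its equation has two columns. They give the B1
    and A2 columns in the second square of \<open>u\<close>; the B2 column is the second square of
    \<open>t\<close>.\<close>
  have "mat [ob1 C T] [B1, A2] [[s1 \<cdot> b0 \<oplus> (s2 \<cdot> f1 \<oplus> d1 T \<cdot> w1), d1 T \<cdot> w2 \<oplus> \<ominus> (s2 \<cdot> a1)]] =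
      mat [ob1 C T] [B1, A2] [[m1 t, \<zero> (ob1 C T) A2]]"
    using e by (simp add: s_eq w_eq c_def diagram_calc row_Comp)
  then have "s1 \<cdot> b0 \<oplus> (s2 \<cdot> f1 \<oplus> d1 T \<cdot> w1) = m1 t \<and> d1 T \<cdot> w2 \<oplus> \<ominus> (s2 \<cdot> a1) = \<zero> (ob1 C T) A2"
    by (subst (asm) matrix_eq_iff) (simp_all add: diagram_calc)
  then have e1: "s1 \<cdot> b0 \<oplus> (s2 \<cdot> f1 \<oplus> d1 T \<cdot> w1) = m1 t" and z: "d1 T \<cdot> w2 \<oplus> \<ominus> (s2 \<cdot> a1) = \<zero> (ob1 C T) A2"
    by simp_all
  have e2: "d1 T \<cdot> w2 = s2 \<cdot> a1"
    by (rule Add_Neg_eq_ZeroD[OF _ _ z]) (simp_all add: diagram_calc)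
  have e1': "m1 t \<oplus> (\<ominus> (s1 \<cdot> b0) \<oplus> \<ominus> (s2 \<cdot> f1)) = d1 T \<cdot> w1"
    unfolding e1[symmetric] by (simp add: diagram_calc)
  have "u \<in> Hom (diag_category C) T I"
    using e1' unfolding u_def by (intro Hom_DI[OF Hom_D_diags(1)[OF t] diags(6)])
      (simp_all add: diagram_calc row_Comp e2)
  moreover have "Comp (diag_category C) u i = t"
    by (rule diag_mor.expand) (simp add: u_def i_def diagram_calc)
  ultimately show "\<exists>u\<in>Hom (diag_category C) T I. Comp (diag_category C) u i = t" by blast
next
  fix T u s w
  assume u: "u \<in> Hom (diag_category C) T I"
    and s: "s \<in> Hom C (ob1 C T) (ob0 C B)" and w: "w \<in> Hom C (ob2 C T) (ob1 C B)"
    and e: "s \<cdot> d0 B \<oplus> d1 T \<cdot> w = m1 u \<cdot> m1 i"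
  note [simp] = diags_arr[OF Hom_D_diags(1)[OF u]] s[unfolded Hom_iff] w[unfolded Hom_iff]
  obtain x y z where u1: "m1 u = mat [ob1 C T] [B1, B0, A1] [[x, y, z]]"
    and [simp]: "x \<in> Arr C" "Dom C x = ob1 C T" "Cod C x = B1" "y \<in> Arr C" "Dom C y = ob1 C T" "Cod C y = B0"
      "z \<in> Arr C" "Dom C z = ob1 C T" "Cod C z = A1"
    by (rule row_cases[of "m1 u" "ob1 C T" "[B1, B0, A1]"])
      (use Hom_D_m1[OF u] in \<open>auto simp: list_all2_Cons1 Hom_iff\<close>)
  have x: "x = s \<cdot> b0 \<oplus> d1 T \<cdot> w" using e by (simp add: u1 i_def diagram_calc)
  show "\<exists>s'\<in>Hom C (ob1 C T) (ob0 C I). \<exists>t'\<in>Hom C (ob2 C T) (ob1 C I). s' \<cdot> d0 I \<oplus> d1 T \<cdot> t' = m1 u"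
    by (rule bexI[of _ "mat [ob1 C T] [B0, B0, A1] [[s, y, z]]"],
        rule bexI[of _ "mat [ob2 C T] [B1, B0, A1] [[w, \<zero> (ob2 C T) B0, \<zero> (ob2 C T) A1]]"])
      (simp_all add: u1 x diagram_calc row_Comp)
qed

section \<open>The inverse of the induced morphism\<close>

lemma is_inverse_h: "is_inverse (Adel C) (adel_class C h) (adel_class C h_inv)"
proof -
  interpret D: preadditive_category "diag_category C" by (rule preadditive_D)
  interpret Q: preadditive_category "Adel C" by (rule preadditive_Adel)
  \<comment> \<open>The middle component of the composite has rows (1, -a1, 0), (0, 0, 0), (0, 0,
    1). It differs from the identity only in the second column, by (-a1, -1, 0), which factors
    through \<open>d1 J\<close>; hence \<open>s\<close> is zero.\<close>
  have "adel_class C (Comp (diag_category C) h h_inv) = adel_class C (Ide (diag_category C) J)"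
    by (rule adel_class_eqI[OF D.Comp_Hom[OF h_Hom h_inv_Hom] D.Ide_Hom, where
        s = "mat [A1, A2, B1] [A0, A1, B0]
          [[\<zero> A1 A0, \<zero> A1 A1, \<zero> A1 B0], [\<zero> A2 A0, \<zero> A2 A1, \<zero> A2 B0], [\<zero> B1 A0, \<zero> B1 A1, \<zero> B1 B0]]" and
        t = "mat [A2, A2, B1] [A1, A2, B1]
          [[\<zero> A2 A1, \<ominus> \<one> A2, \<zero> A2 B1], [\<zero> A2 A1, \<ominus> \<one> A2, \<zero> A2 B1], [\<zero> B1 A1, \<zero> B1 A2, \<zero> B1 B1]]"])
      (simp_all add: diags h_def h_inv_def diagram_calc Ide_matrix)
  then have 1: "Comp (Adel C) (adel_class C h) (adel_class C h_inv) = Ide (Adel C) J"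
    using Adel_simps(4)[OF h_Hom h_inv_Hom] by (simp add: Adel_simps(3))
  \<comment> \<open>Here the deviation from the identity is the single row (-b0, -1, 0) in the place
    of B0. It factors through \<open>d0 I\<close>, hence \<open>t\<close> is zero.\<close>
  have "adel_class C (Comp (diag_category C) h_inv h) = adel_class C (Ide (diag_category C) I)"
    by (rule adel_class_eqI[OF D.Comp_Hom[OF h_inv_Hom h_Hom] D.Ide_Hom, where
        s = "mat [B1, B0, A1] [B0, B0, A1]
          [[\<zero> B1 B0, \<zero> B1 B0, \<zero> B1 A1], [\<ominus> \<one> B0, \<ominus> \<one> B0, \<zero> B0 A1], [\<zero> A1 B0, \<zero> A1 B0, \<zero> A1 A1]]" and
        t = "mat [B2, B1, A2] [B1, B0, A1]
          [[\<zero> B2 B1, \<zero> B2 B0, \<zero> B2 A1], [\<zero> B1 B1, \<zero> B1 B0, \<zero> B1 A1], [\<zero> A2 B1, \<zero> A2 B0, \<zero> A2 A1]]"])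
      (simp_all add: diags h_def h_inv_def diagram_calc Ide_matrix)
  then have 2: "Comp (Adel C) (adel_class C h_inv) (adel_class C h) = Ide (Adel C) I"
    using Adel_simps(4)[OF h_inv_Hom h_Hom] by (simp add: Adel_simps(3))
  have "adel_class C h \<in> Hom (Adel C) J I" "adel_class C h_inv \<in> Hom (Adel C) I J"
    using h_Hom h_inv_Hom by (simp_all add: Adel_simps(1))
  with 1 2 show ?thesis by (simp add: is_inverse_def Q.Hom_iff)
qed

lemma factorisation: "kernel_cokernel_factorisation (Adel C) (adel_class C F) (adel_class C k)
  (adel_class C c) (adel_class C p) (adel_class C i) (adel_class C h)"
proof -
  interpret D: preadditive_category "diag_category C" by (rule preadditive_D)
  interpret Q: preadditive_category "Adel C" by (rule preadditive_Adel)
  have H: "adel_class C p \<in> Hom (Adel C) A J" "adel_class C i \<in> Hom (Adel C) I B"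
    "adel_class C h \<in> Hom (Adel C) J I"
    using p_Hom i_Hom h_Hom by (simp_all add: Adel_simps(1))
  have "Comp (diag_category C) (Comp (diag_category C) p h) i = F"
    by (rule diag_mor.expand) (simp add: p_def h_def i_def F_def diagram_calc)
  then have "Comp (Adel C) (Comp (Adel C) (adel_class C p) (adel_class C h)) (adel_class C i) = adel_class C F"
    using Adel_simps(4)[OF p_Hom h_Hom] Adel_simps(4)[OF D.Comp_Hom[OF p_Hom h_Hom] i_Hom] by simp
  then show ?thesis
    unfolding kernel_cokernel_factorisation_def
    using is_kernel_k is_cokernel_c is_cokernel_p is_kernel_i H
    by (auto intro!: Q.is_induced_morphismI simp: Q.Hom_iff)
qed

end

section \<open>The factorisation for a given morphism of diagrams\<close>

theorem corollary35:
  fixes \<A> :: "('o, 'm) precat" (structure)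
    and ds :: "('o, 'm) dsums"
    and A B K C J I :: "'m diag"
    and f :: "'m diag_mor"
    and k c p i h h_inv :: "'m diag_mor set"
  assumes additive: "additive_category \<A>"
    and sums: "direct_sum_choice \<A> ds"
    and "A = Diag a0 a1" and "B = Diag b0 b1"
    and "f = Mor A B f0 f1 f2"
    and f: "f \<in> Hom (diag_category \<A>) A B"
    and "A0 = ob0 \<A> A" and "A1 = ob1 \<A> A" and "A2 = ob2 \<A> A"
    and "B0 = ob0 \<A> B" and "B1 = ob1 \<A> B" and "B2 = ob2 \<A> B"
    and "mat = matrix \<A> ds"
    and "K = Diag
      (mat [A0, B0] [A1, B0]
        [[a0,         \<zero> A0 B0],
         [\<zero> B0 A1,   \<one> B0]])
      (mat [A1, B0] [A2, B1]
        [[a1,         f1],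
         [\<zero> B0 A2,   \<ominus> b0]])"
    and "C = Diag
      (mat [B0, A1] [B1, A2]
        [[b0,         \<zero> B0 A2],
         [f1,         \<ominus> a1]])
      (mat [B1, A2] [B2, A2]
        [[b1,         \<zero> B1 A2],
         [\<zero> A2 B2,   \<one> A2]])"
    and "J = Diag
      (mat [A0, A1, B0] [A1, A2, B1]
        [[a0,         \<zero> A0 A2,   \<zero> A0 B1],
         [\<one> A1,      \<ominus> a1,      \<ominus> f1],
         [\<zero> B0 A1,   \<zero> B0 A2,   b0]])
      (mat [A1, A2, B1] [A2, A2, B1]
        [[a1,         \<zero> A1 A2,   \<zero> A1 B1],
         [\<zero> A2 A2,   \<one> A2,      \<zero> A2 B1],
         [\<zero> B1 A2,   \<zero> B1 A2,   \<one> B1]])"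
    and "I = Diag
      (mat [B0, B0, A1] [B1, B0, A1]
        [[b0,         \<zero> B0 B0,   \<zero> B0 A1],
         [\<zero> B0 B1,   \<one> B0,      \<zero> B0 A1],
         [\<zero> A1 B1,   \<zero> A1 B0,   \<one> A1]])
      (mat [B1, B0, A1] [B2, B1, A2]
        [[b1,         \<one> B1,      \<zero> B1 A2],
         [\<zero> B0 B2,   \<ominus> b0,      \<zero> B0 A2],
         [\<zero> A1 B2,   \<ominus> f1,      a1]])"
    and "k = adel_class \<A> (Mor K A
      (mat [A0, B0] [A0] [[\<one> A0], [\<zero> B0 A0]])
      (mat [A1, B0] [A1] [[\<one> A1], [\<zero> B0 A1]])
      (mat [A2, B1] [A2] [[\<one> A2], [\<zero> B1 A2]]))"
    and "c = adel_class \<A> (Mor B C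
      (mat [B0] [B0, A1] [[\<one> B0, \<zero> B0 A1]])
      (mat [B1] [B1, A2] [[\<one> B1, \<zero> B1 A2]])
      (mat [B2] [B2, A2] [[\<one> B2, \<zero> B2 A2]]))"
    and "p = adel_class \<A> (Mor A J
      (mat [A0] [A0, A1, B0] [[\<one> A0, \<zero> A0 A1, \<zero> A0 B0]])
      (mat [A1] [A1, A2, B1] [[\<one> A1, \<zero> A1 A2, \<zero> A1 B1]])
      (mat [A2] [A2, A2, B1] [[\<one> A2, \<zero> A2 A2, \<zero> A2 B1]]))"
    and "i = adel_class \<A> (Mor I B
      (mat [B0, B0, A1] [B0] [[\<one> B0], [\<zero> B0 B0], [\<zero> A1 B0]])
      (mat [B1, B0, A1] [B1] [[\<one> B1], [\<zero> B0 B1], [\<zero> A1 B1]])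
      (mat [B2, B1, A2] [B2] [[\<one> B2], [\<zero> B1 B2], [\<zero> A2 B2]]))"
    and "h = adel_class \<A> (Mor J I
      (mat [A0, A1, B0] [B0, B0, A1]
        [[f0,         \<zero> A0 B0,   a0],
         [\<zero> A1 B0,   \<zero> A1 B0,   \<one> A1],
         [\<one> B0,      \<zero> B0 B0,   \<zero> B0 A1]])
      (mat [A1, A2, B1] [B1, B0, A1]
        [[f1,         \<zero> A1 B0,   \<one> A1],
         [\<zero> A2 B1,   \<zero> A2 B0,   \<zero> A2 A1],
         [\<one> B1,      \<zero> B1 B0,   \<zero> B1 A1]])
      (mat [A2, A2, B1] [B2, B1, A2]
        [[f2,         \<zero> A2 B1,   \<one> A2],
         [\<zero> A2 B2,   \<zero> A2 B1,   \<zero> A2 A2],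
         [b1,         \<one> B1,      \<zero> B1 A2]]))"
    and "h_inv = adel_class \<A> (Mor I J
      (mat [B0, B0, A1] [A0, A1, B0]
        [[\<zero> B0 A0,   \<zero> B0 A1,   \<one> B0],
         [\<zero> B0 A0,   \<zero> B0 A1,   \<ominus> \<one> B0],
         [\<zero> A1 A0,   \<one> A1,      \<zero> A1 B0]])
      (mat [B1, B0, A1] [A1, A2, B1]
        [[\<zero> B1 A1,   \<zero> B1 A2,   \<one> B1],
         [\<zero> B0 A1,   \<zero> B0 A2,   \<ominus> b0],
         [\<one> A1,      \<ominus> a1,      \<ominus> f1]])
      (mat [B2, B1, A2] [A2, A2, B1]
        [[\<zero> B2 A2,   \<zero> B2 A2,   \<zero> B2 B1],
         [\<zero> B1 A2,   \<zero> B1 A2,   \<one> B1],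
         [\<one> A2,      \<ominus> \<one> A2,   \<zero> A2 B1]]))"
  shows "{K, C, J, I} \<subseteq> Obj (Adel \<A>)
    \<and> adel_class \<A> f \<in> Hom (Adel \<A>) A B
    \<and> k \<in> Hom (Adel \<A>) K A
    \<and> c \<in> Hom (Adel \<A>) B C
    \<and> p \<in> Hom (Adel \<A>) A J
    \<and> i \<in> Hom (Adel \<A>) I B
    \<and> h \<in> Hom (Adel \<A>) J I
    \<and> h_inv \<in> Hom (Adel \<A>) I J
    \<and> kernel_cokernel_factorisation (Adel \<A>) (adel_class \<A> f) k c p i h
    \<and> is_inverse (Adel \<A>) h h_inv"
proof -
  interpret additive_category \<A> by (rule additive)
  have F: "f \<in> Hom (diag_category \<A>) (Diag a0 a1) (Diag b0 b1)" using f assms(3,4) by simp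
  have Hs: "a0 \<in> Hom \<A> A0 A1" "a1 \<in> Hom \<A> A1 A2" "b0 \<in> Hom \<A> B0 B1" "b1 \<in> Hom \<A> B1 B2"
    "f0 \<in> Hom \<A> A0 B0" "f1 \<in> Hom \<A> A1 B1" "f2 \<in> Hom \<A> A2 B2"
    "a0 \<cdot> f1 = f0 \<cdot> b0" "a1 \<cdot> f2 = f1 \<cdot> b1"
    using diags_Hom[OF Hom_D_diags(1)[OF F]] diags_Hom[OF Hom_D_diags(2)[OF F]]
      Hom_D_m[OF F] Hom_D_sq0[OF F] Hom_D_sq1[OF F]
    by (simp_all add: assms(3-5,7-12))
  interpret M: diagram_morphism \<A> ds a0 a1 b0 b1 f0 f1 f2 A0 A1 A2 B0 B1 B2
    by unfold_locales (use sums Hs in simp_all)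
  \<comment> \<open>Rewriting with \<open>only\<close> the defining equations leaves the literal
    matrices unevaluated, so both sides unfold to the same term.\<close>
  have objs: "A = M.A" "B = M.B" "K = M.K" "C = M.Q" "J = M.J" "I = M.I"
    by (simp_all only: assms(3,4,13-17) M.A_def M.B_def M.K_def M.Q_def M.J_def M.I_def)
  have mors: "f = M.F" "k = adel_class \<A> M.k" "c = adel_class \<A> M.c" "p = adel_class \<A> M.p"
    "i = adel_class \<A> M.i" "h = adel_class \<A> M.h" "h_inv = adel_class \<A> M.h_inv"
    by (simp_all only: assms(5,13,18-23) objs M.F_def M.k_def M.c_def M.p_def M.i_def M.h_def M.h_inv_def)
  show ?thesis
    unfolding objs mors
    using M.diags M.F_Hom M.k_Hom M.c_Hom M.p_Hom M.i_Hom M.h_Hom M.h_inv_Hom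
      M.factorisation M.is_inverse_h
    by (simp add: Adel_simps(1,2))
qed

end
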